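(* Let $\mathfrak{g}$ be a simply laced Lie algebra and let $V$ be a finite-dimensional (type I) $U_{-q^2}$-module. Then the $U^{\iota}_{-q^2}$-module $V\otimes\mathcal{N}$ is (type I) nonclassical. As operators on $V\otimes\mathcal{N}$, the nonclassical $\iota$quantum Weyl group generators $$\Delta({}^{\iota}T_i)=\sum_{k\ge0}q^{-k}\Delta(\mathsf{x}_i^{(k)})$$ are invertible and satisfy the braid relations of the braid group $\mathrm{Br}_{\mathfrak{g}}$.
   Context: $[k]_v=\frac{v^k-v^{-k}}{v-v^{-1}}$, $[k]=[k]_q$, $q$ an indeterminate; for $k\le\ell$, $D(k,\ell)=\sum_{i=0}^{k-1}(-1)^i[\ell+k-1-2i]$. $\mathfrak{g}$ is a (finite-dimensional, simple, complex) simply laced Lie algebra with Cartan matrix $(a_{ij})$. $U_{-q^2}$ is the Drinfeld–Jimbo quantum group of $\mathfrak{g}$ over $\mathbb{C}(q)$ with parameter $v=-q^2$: generators $e_i,f_i,k_i^{\pm1}$, commuting $k_i$, $k_ie_j=v^{a_{ij}}e_jk_i$, $k_if_j=v^{-a_{ij}}f_jk_i$, $[e_i,f_j]=\delta_{ij}\frac{k_i-k_i^{-1}}{v-v^{-1}}$, and the quantum Serre relations; coproduct $\Delta(e_i)=e_i\otimes k_i+1\otimes e_i$, $\Delta(f_i)=f_i\otimes1+k_i^{-1}\otimes f_i$, $\Delta(k_i)=k_i\otimes k_i$. Type I means that the $k_i$ act diagonalizably with eigenvalues integer powers of $v$. $U^{\iota}_{-q^2}\subset U_{-q^2}$ is the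 subalgebra (split $\iota$quantum group) generated by $b_i=f_i+(-q^2)^{-1}e_ik_i^{-1}$. One has $\Delta(b_i)=b_i\otimes1+k_i^{-1}\otimes b_i$, so if $V$ is a $U_{-q^2}$-module and $N$ a $U^{\iota}_{-q^2}$-module then $V\otimes N$ is a $U^{\iota}_{-q^2}$-module via $\Delta$. $\mathcal{N}=\mathbb{C}(q)\{1_{\mathcal{N}}\}$ is the one-dimensional $U^{\iota}_{-q^2}$-module with $b_i\cdot1_{\mathcal{N}}=\frac1{[2]}1_{\mathcal{N}}$ for all $i$. A $U^{\iota}_{-q^2}$-representation is (type I) nonclassical if each $b_i$ acts diagonalizably with eigenvalues in $\{(-1)^k\frac{[2k+1]}{[2]}\}_{k\in\mathbb{Z}_{\ge0}}$. $\mathsf{x}_i^{(0)}=1$, $\mathsf{x}_i=\mathsf{x}_i^{(1)}=b_i-\frac1{[2]}$, $\mathsf{x}_i^{(k+1)}=\frac{(-1)^k}{[k+1]_{q^2}}\big(\mathsf{x}_i^{(k)}\mathsf{x}_i-(-1)^kD(k,k+1)\mathsf{x}_i^{(k)}\big)$ for $k\ge1$; on a finite-dimensional (type I) nonclassical representation these act by zero for $k\gg0$. ${}^{\iota}T_i=\sum_{k\ge0}q^{-k}\mathsf{x}_i^{(k)}$. The braid relations of $\mathrm{Br}_{\mathfrak{g}}$ are $T_iT_jT_i=T_jT_iT_j$ if $a_{ij}=-1$ and $T_iT_j=T_jT_i$ if $a_{ij}=0$. *)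

theory Defs
  imports
    "HOL-Algebra.Algebraic_Closure_Type"
    "HOL-Algebra.Generated_Rings"
    "HOL-Computational_Algebra.Fraction_Field"
    "HOL-Library.Poly_Mapping"
    "HOL-Library.Product_Plus"
begin

section \<open>The ground field and quantum integers\<close>

type_synonym Cq = "complex poly fract"

definition qq :: Cq where
  "qq = Fract [:0, 1:] 1"

definition vv :: Cq where
  "vv = - (qq ^ 2)"

definition qint :: "Cq \<Rightarrow> int \<Rightarrow> Cq" where
  "qint v k = (v powi k - v powi (- k)) / (v - inverse v)"

definition D_coeff :: "nat \<Rightarrow> nat \<Rightarrow> Cq" where
  "D_coeff k l = (\<Sum>i<k. (- 1) ^ i * qint qq (int l + int k - 1 - 2 * int i))"


section \<open>Simply laced Cartan matrices\<close>

text \<open>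
  A finite-dimensional simple complex Lie algebra enters only through its Cartan matrix: an
  indecomposable matrix of finite type. In the simply laced case the matrix is symmetric, so that
  finite type means positive definiteness. The nodes of the Dynkin diagram are the elements of
  a finite (hence nonempty) type.
\<close>

definition simply_laced_cartan :: "('i::finite \<Rightarrow> 'i \<Rightarrow> int) \<Rightarrow> bool" where
  "simply_laced_cartan a \<longleftrightarrow>
     (\<forall>i. a i i = 2) \<and>
     (\<forall>i j. i \<noteq> j \<longrightarrow> a i j \<in> {0, - 1}) \<and>
     (\<forall>i j. a i j = a j i) \<and>
     (\<forall>x :: 'i \<Rightarrow> real. x \<noteq> (\<lambda>_. 0) \<longrightarrow> 0 < (\<Sum>i\<in>UNIV. \<Sum>j\<in>UNIV. of_int (a i j) * x i * x j)) \<and>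
     (\<forall>J. J \<noteq> {} \<and> J \<noteq> UNIV \<longrightarrow> (\<exists>i\<in>J. \<exists>j\<in>-J. a i j \<noteq> 0))"


section \<open>Free algebras and their tensor squares\<close>

text \<open>
  The free algebra on a set of letters is the monoid algebra of the free monoid of words, whose
  monoid operation is written additively, as the convolution product of
  \<^typ>\<open>'m \<Rightarrow>\<^sub>0 'k\<close> requires. Its tensor square is the monoid algebra of the monoid of pairs of words.
\<close>

datatype 'g word = Word "'g list"

instantiation word :: (type) monoid_add
begin

definition zero_word :: "'a word" where
  "zero_word = Word []"

fun plus_word :: "'a word \<Rightarrow> 'a word \<Rightarrow> 'a word" where
  "plus_word (Word xs) (Word ys) = Word (xs @ ys)"

instance
proof
  fix a b c :: "'a word"
  show "a + b + c = a + (b + c)"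
    by (cases a; cases b; cases c) simp
  show "0 + a = a"
    by (cases a) (simp add: zero_word_def)
  show "a + 0 = a"
    by (cases a) (simp add: zero_word_def)
qed

end

type_synonym 'g free_alg = "'g word \<Rightarrow>\<^sub>0 Cq"
type_synonym 'g free_alg2 = "('g word \<times> 'g word) \<Rightarrow>\<^sub>0 Cq"

definition letter :: "'g \<Rightarrow> 'g free_alg" where
  "letter g = Poly_Mapping.single (Word [g]) 1"

definition scal :: "Cq \<Rightarrow> ('m::monoid_add \<Rightarrow>\<^sub>0 Cq)" where
  "scal c = Poly_Mapping.single 0 c"

definition tens :: "'g free_alg \<Rightarrow> 'g free_alg \<Rightarrow> 'g free_alg2" where
  "tens x y = (\<Sum>u\<in>Poly_Mapping.keys x. \<Sum>w\<in>Poly_Mapping.keys y.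
     Poly_Mapping.single (u, w) (Poly_Mapping.lookup x u * Poly_Mapping.lookup y w))"


section \<open>The quantum group\<close>

datatype 'i gen = Egen 'i | Fgen 'i | Kgen 'i | Kinvgen 'i

abbreviation e :: "'i \<Rightarrow> 'i gen free_alg" where "e i \<equiv> letter (Egen i)"
abbreviation f :: "'i \<Rightarrow> 'i gen free_alg" where "f i \<equiv> letter (Fgen i)"
abbreviation k :: "'i \<Rightarrow> 'i gen free_alg" where "k i \<equiv> letter (Kgen i)"
abbreviation k' :: "'i \<Rightarrow> 'i gen free_alg" where "k' i \<equiv> letter (Kinvgen i)"

definition relators :: "('i \<Rightarrow> 'i \<Rightarrow> int) \<Rightarrow> 'i gen free_alg set" where
  "relators a =
     {k i * k' i - 1 | i. True} \<union> {k' i * k i - 1 | i. True} \<union>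
     {k i * k j - k j * k i | i j. True} \<union>
     {k i * e j - scal (vv powi a i j) * e j * k i | i j. True} \<union>
     {k i * f j - scal (vv powi (- a i j)) * f j * k i | i j. True} \<union>
     {e i * f i - f i * e i - scal (inverse (vv - inverse vv)) * (k i - k' i) | i. True} \<union>
     {e i * f j - f j * e i | i j. i \<noteq> j} \<union>
     {e i * e j - e j * e i | i j. i \<noteq> j \<and> a i j = 0} \<union>
     {f i * f j - f j * f i | i j. i \<noteq> j \<and> a i j = 0} \<union>
     {e i * e i * e j - scal (qint vv 2) * e i * e j * e i + e j * e i * e i | i j. a i j = - 1} \<union>
     {f i * f i * f j - scal (qint vv 2) * f i * f j * f i + f j * f i * f i | i j. a i j = - 1}"

definition U_ideal :: "('i \<Rightarrow> 'i \<Rightarrow> int) \<Rightarrow> 'i gen free_alg set" where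
  "U_ideal a = Idl\<^bsub>ring_of_type_algebra\<^esub> (relators a)"

definition U :: "('i \<Rightarrow> 'i \<Rightarrow> int) \<Rightarrow> 'i gen free_alg set ring" where
  "U a = ring_of_type_algebra Quot U_ideal a"

definition cls :: "('i \<Rightarrow> 'i \<Rightarrow> int) \<Rightarrow> 'i gen free_alg \<Rightarrow> 'i gen free_alg set" where
  "cls a x = U_ideal a +>\<^bsub>ring_of_type_algebra\<^esub> x"

text \<open>The tensor square of the quantum group is a quotient of the tensor square of the free algebra.\<close>

definition U2_ideal :: "('i \<Rightarrow> 'i \<Rightarrow> int) \<Rightarrow> 'i gen free_alg2 set" where
  "U2_ideal a = Idl\<^bsub>ring_of_type_algebra\<^esub>
     ({tens r 1 | r. r \<in> relators a} \<union> {tens 1 r | r. r \<in> relators a})"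

definition cls2 :: "('i \<Rightarrow> 'i \<Rightarrow> int) \<Rightarrow> 'i gen free_alg2 \<Rightarrow> 'i gen free_alg2 set" where
  "cls2 a x = U2_ideal a +>\<^bsub>ring_of_type_algebra\<^esub> x"

text \<open>
  The coproduct, as a homomorphism between the free algebra and its tensor square; the coproduct
  of the class of \<open>x\<close> in the quantum group is the class of \<open>coproduct x\<close>.
\<close>

fun coproduct_gen :: "'i gen \<Rightarrow> 'i gen free_alg2" where
  "coproduct_gen (Egen i) = tens (e i) (k i) + tens 1 (e i)"
| "coproduct_gen (Fgen i) = tens (f i) 1 + tens (k' i) (f i)"
| "coproduct_gen (Kgen i) = tens (k i) (k i)"
| "coproduct_gen (Kinvgen i) = tens (k' i) (k' i)"

fun coproduct_word :: "'i gen word \<Rightarrow> 'i gen free_alg2" where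
  "coproduct_word (Word gs) = prod_list (map coproduct_gen gs)"

definition coproduct :: "'i gen free_alg \<Rightarrow> 'i gen free_alg2" where
  "coproduct x =
     (\<Sum>w\<in>Poly_Mapping.keys x. scal (Poly_Mapping.lookup x w) * coproduct_word w)"


section \<open>The split iquantum group\<close>

definition b :: "('i \<Rightarrow> 'i \<Rightarrow> int) \<Rightarrow> 'i \<Rightarrow> 'i gen free_alg set" where
  "b a i = cls a (f i + scal (inverse vv) * e i * k' i)"

definition U_iota :: "('i \<Rightarrow> 'i \<Rightarrow> int) \<Rightarrow> 'i gen free_alg set ring" where
  "U_iota a = (U a)\<lparr>carrier := generate_ring (U a) (range (\<lambda>c. cls a (scal c)) \<union> range (b a))\<rparr>"

text \<open>\<open>xdp a i k\<close> is the element \<open>x\<^sub>i\<^sup>(\<^sup>k\<^sup>)\<close>.\<close>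

fun xdp :: "('i \<Rightarrow> 'i \<Rightarrow> int) \<Rightarrow> 'i \<Rightarrow> nat \<Rightarrow> 'i gen free_alg set" where
  "xdp a i 0 = \<one>\<^bsub>U a\<^esub>"
| "xdp a i (Suc 0) = b a i \<ominus>\<^bsub>U a\<^esub> cls a (scal (1 / qint qq 2))"
| "xdp a i (Suc (Suc n)) =
     (let m = Suc n in
       cls a (scal ((- 1) ^ m / qint (qq ^ 2) (int m + 1))) \<otimes>\<^bsub>U a\<^esub>
         (xdp a i m \<otimes>\<^bsub>U a\<^esub> xdp a i 1
           \<ominus>\<^bsub>U a\<^esub> cls a (scal ((- 1) ^ m * D_coeff m (m + 1))) \<otimes>\<^bsub>U a\<^esub> xdp a i m))"


section \<open>Modules\<close>

text \<open>
  A vector space over \<^typ>\<open>Cq\<close> is given by its scalar multiplication \<open>s\<close> on a type of class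
  \<^class>\<open>ab_group_add\<close>.
\<close>

definition End_ring :: "(Cq \<Rightarrow> 'v::ab_group_add \<Rightarrow> 'v) \<Rightarrow> ('v \<Rightarrow> 'v) ring" where
  "End_ring s = \<lparr>carrier = {g. Vector_Spaces.linear s s g}, monoid.mult = (\<circ>), one = id,
     zero = (\<lambda>_. 0), add = (\<lambda>g h v. g v + h v)\<rparr>"

text \<open>A module over a subalgebra \<open>R\<close> of the quantum group.\<close>

definition is_module ::
    "('i \<Rightarrow> 'i \<Rightarrow> int) \<Rightarrow> 'i gen free_alg set ring \<Rightarrow> (Cq \<Rightarrow> 'v::ab_group_add \<Rightarrow> 'v)
      \<Rightarrow> ('i gen free_alg set \<Rightarrow> 'v \<Rightarrow> 'v) \<Rightarrow> bool" where
  "is_module a R s \<rho> \<longleftrightarrow>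
     vector_space s \<and> \<rho> \<in> ring_hom R (End_ring s) \<and> (\<forall>c. \<rho> (cls a (scal c)) = s c)"

definition is_basis :: "(Cq \<Rightarrow> 'v::ab_group_add \<Rightarrow> 'v) \<Rightarrow> 'v set \<Rightarrow> bool" where
  "is_basis s B \<longleftrightarrow> \<not> module.dependent s B \<and> module.span s B = UNIV"

definition diagonalizable_with ::
    "(Cq \<Rightarrow> 'v::ab_group_add \<Rightarrow> 'v) \<Rightarrow> Cq set \<Rightarrow> ('v \<Rightarrow> 'v) \<Rightarrow> bool" where
  "diagonalizable_with s S g \<longleftrightarrow> (\<exists>B. is_basis s B \<and> (\<forall>w\<in>B. \<exists>c\<in>S. g w = s c w))"

definition type_I ::
    "('i \<Rightarrow> 'i \<Rightarrow> int) \<Rightarrow> (Cq \<Rightarrow> 'v::ab_group_add \<Rightarrow> 'v) \<Rightarrow> ('i gen free_alg set \<Rightarrow> 'v \<Rightarrow> 'v) \<Rightarrow> bool" where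
  "type_I a s \<rho> \<longleftrightarrow> (\<forall>i. diagonalizable_with s (range (\<lambda>n :: int. vv powi n)) (\<rho> (cls a (k i))))"

definition nonclassical ::
    "('i \<Rightarrow> 'i \<Rightarrow> int) \<Rightarrow> (Cq \<Rightarrow> 'v::ab_group_add \<Rightarrow> 'v) \<Rightarrow> ('i gen free_alg set \<Rightarrow> 'v \<Rightarrow> 'v) \<Rightarrow> bool" where
  "nonclassical a s \<sigma> \<longleftrightarrow> is_module a (U_iota a) s \<sigma> \<and>
     (\<forall>i. diagonalizable_with s
        (range (\<lambda>n :: nat. (- 1) ^ n * qint qq (2 * int n + 1) / qint qq 2)) (\<sigma> (b a i)))"

text \<open>The one-dimensional module \<open>N\<close>, spanned by \<open>u\<close>.\<close>

definition is_N ::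
    "('i \<Rightarrow> 'i \<Rightarrow> int) \<Rightarrow> (Cq \<Rightarrow> 'n::ab_group_add \<Rightarrow> 'n) \<Rightarrow> ('i gen free_alg set \<Rightarrow> 'n \<Rightarrow> 'n)
      \<Rightarrow> 'n \<Rightarrow> bool" where
  "is_N a s \<chi> u \<longleftrightarrow> is_module a (U_iota a) s \<chi> \<and> is_basis s {u} \<and>
     (\<forall>i. \<chi> (b a i) u = s (1 / qint qq 2) u)"

text \<open>\<open>t\<close> exhibits the third vector space as the tensor product of the first two.\<close>

definition is_tensor_product ::
    "(Cq \<Rightarrow> 'v::ab_group_add \<Rightarrow> 'v) \<Rightarrow> (Cq \<Rightarrow> 'n::ab_group_add \<Rightarrow> 'n)
      \<Rightarrow> (Cq \<Rightarrow> 'w::ab_group_add \<Rightarrow> 'w) \<Rightarrow> ('v \<Rightarrow> 'n \<Rightarrow> 'w) \<Rightarrow> bool" where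
  "is_tensor_product sV sN sW t \<longleftrightarrow>
     (\<forall>n. Vector_Spaces.linear sV sW (\<lambda>v. t v n)) \<and> (\<forall>v. Vector_Spaces.linear sN sW (t v)) \<and>
     (\<forall>B C. is_basis sV B \<and> is_basis sN C \<longrightarrow>
        inj_on (\<lambda>(v, n). t v n) (B \<times> C) \<and> is_basis sW ((\<lambda>(v, n). t v n) ` (B \<times> C)))"

text \<open>
  \<open>\<sigma>\<close> is the action on the tensor product of a module of the quantum group and a module of the
  iquantum group through the coproduct: whenever the coproduct of an element of the iquantum group
  is written as a sum of pure tensors with second factors in the iquantum group, the element acts
  by the corresponding sum. All elements are given by representatives in the free algebra.
\<close>

definition acts_via_coproduct ::
    "('i \<Rightarrow> 'i \<Rightarrow> int) \<Rightarrow> ('i gen free_alg set \<Rightarrow> 'v \<Rightarrow> 'v) \<Rightarrow> ('i gen free_alg set \<Rightarrow> 'n \<Rightarrow> 'n)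
      \<Rightarrow> ('v \<Rightarrow> 'n \<Rightarrow> 'w::ab_group_add) \<Rightarrow> ('i gen free_alg set \<Rightarrow> 'w \<Rightarrow> 'w) \<Rightarrow> bool" where
  "acts_via_coproduct a \<rho> \<chi> t \<sigma> \<longleftrightarrow>
     (\<forall>x ps. cls a x \<in> carrier (U_iota a) \<and> (\<forall>(y, z) \<in> set ps. cls a z \<in> carrier (U_iota a)) \<and>
        cls2 a (coproduct x) = cls2 a (\<Sum>(y, z)\<leftarrow>ps. tens y z) \<longrightarrow>
        (\<forall>v n. \<sigma> (cls a x) (t v n) = (\<Sum>(y, z)\<leftarrow>ps. t (\<rho> (cls a y) v) (\<chi> (cls a z) n))))"

text \<open>
  \<^const>\<open>Sum_any\<close> sums the nonzero terms of a family if these are finitely many, and is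
  \<open>0\<close> otherwise.
\<close>

definition iT ::
    "('i \<Rightarrow> 'i \<Rightarrow> int) \<Rightarrow> (Cq \<Rightarrow> 'v::ab_group_add \<Rightarrow> 'v) \<Rightarrow> ('i gen free_alg set \<Rightarrow> 'v \<Rightarrow> 'v)
      \<Rightarrow> 'i \<Rightarrow> 'v \<Rightarrow> 'v" where
  "iT a s \<sigma> i w = Sum_any (\<lambda>n :: nat. s (qq powi (- int n)) (\<sigma> (xdp a i n) w))"

hide_const (open) e f k k' b

end

theory Submission
  imports Defs
begin

text \<open>
  On \<open>V \<otimes> \<N> \<cong> V\<close> the generator \<open>b\<^sub>i\<close> acts by \<open>B\<^sub>i = f\<^sub>i + v\<^sup>-\<^sup>1 e\<^sub>i k\<^sub>i\<^sup>-\<^sup>1 + [2]\<^sup>-\<^sup>1 k\<^sub>i\<^sup>-\<^sup>1\<close>. A \<open>q\<close>-exponential of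
  \<open>e\<^sub>i\<close> conjugates \<open>B\<^sub>i\<close> to a triangular operator with the scalar
  \<open>\<lambda>\<^sub>m = (q v\<^sup>m - q\<^sup>-\<^sup>1 v\<^sup>-\<^sup>m) / (v\<^sup>-\<^sup>1 - v)\<close> on the weight space of weight \<open>m\<close>; since \<open>\<lambda>\<^sub>m = \<lambda>\<^sub>-\<^sub>1\<^sub>-\<^sub>m\<close>
  are the only coincidences and the parity of weights is preserved, \<open>B\<^sub>i\<close> is diagonalizable, with
  eigenvalues \<open>\<lambda>\<^sub>j = (-1)\<^sup>j [2j+1] / [2]\<close>, \<open>j \<ge> 0\<close>. By the \<open>q\<close>-Chu-Vandermonde formula \<open>T\<^sub>i\<close> acts by
  \<open>\<tau>\<^sub>j = v\<^bsup>-j(j+1)/2\<^esup>\<close> on the eigenspace for \<open>\<lambda>\<^sub>j\<close>.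

  If \<open>a\<^sub>i\<^sub>j = -1\<close>, then \<open>B\<^sub>i\<^sup>2 B\<^sub>j - (v + v\<^sup>-\<^sup>1) B\<^sub>i B\<^sub>j B\<^sub>i + B\<^sub>j B\<^sub>i\<^sup>2 = B\<^sub>j\<close>, which says that \<open>B\<^sub>j\<close> maps the
  eigenspace of \<open>B\<^sub>i\<close> for \<open>\<lambda>\<^sub>m\<close> to the sum of those for \<open>\<lambda>\<^sub>m\<^sub>+\<^sub>1\<close> and \<open>\<lambda>\<^sub>m\<^sub>-\<^sub>1\<close>. As the ratio of \<open>\<tau>\<^sub>m\<^sub>\<plusminus>\<^sub>1\<close> and
  \<open>\<tau>\<^sub>m\<close> is \<open>q\<^sup>-\<^sup>1 \<lambda>\<^sub>m\<^sub>\<plusminus>\<^sub>1 + q \<lambda>\<^sub>m\<close>, the element \<open>Z = q\<^sup>-\<^sup>1 B\<^sub>i B\<^sub>j + q B\<^sub>j B\<^sub>i\<close> satisfies both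
  \<open>T\<^sub>i B\<^sub>j = Z T\<^sub>i\<close> and \<open>B\<^sub>i T\<^sub>j = T\<^sub>j Z\<close>. Hence \<open>T\<^sub>j T\<^sub>i\<close> intertwines \<open>B\<^sub>j\<close> with \<open>B\<^sub>i\<close>, and therefore
  \<open>T\<^sub>j\<close> with \<open>T\<^sub>i\<close>.
\<close>

section \<open>Scalars\<close>

text \<open>Positive powers of the indeterminate have positive degree. That q is not a root of unity
  underlies the nonvanishing of the scalars below.\<close>

lemma qq_pow_ne_1:
  assumes "n > 0" shows "qq ^ n \<noteq> 1"
proof
  assume eq: "qq ^ n = 1"
  have *: "Fract p 1 ^ n = Fract (p ^ n) 1" for p :: "complex poly"
    by (induction n) (auto simp: One_fract_def)
  have "[:0, 1:] ^ n = (1 :: complex poly)"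
    using eq unfolding qq_def * by (simp add: One_fract_def eq_fract)
  then have "degree ([:0, 1 :: complex:] ^ n) = 0" by simp
  then show False using assms by (simp add: degree_power_eq)
qed

lemma qq_nonzero [simp]: "qq \<noteq> 0"
  by (simp add: qq_def Zero_fract_def eq_fract)

lemma vv_nonzero [simp]: "vv \<noteq> 0"
  by (simp add: vv_def)

lemma vv_powi_eq_1_iff [simp]: "vv powi n = 1 \<longleftrightarrow> n = 0"
proof
  assume eq: "vv powi n = 1"
  show "n = 0"
  proof (rule ccontr)
    assume "n \<noteq> 0"
    \<comment> \<open>The square of \<open>vv\<close> is the fourth power of \<open>qq\<close>,
      which removes the sign in v = -q^2.\<close>
    then have pos: "4 * nat \<bar>n\<bar> > 0" by simp
    have "vv ^ nat \<bar>n\<bar> = 1"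
      using eq by (cases "n \<ge> 0") (auto simp: power_int_def field_simps)
    then have "(vv ^ nat \<bar>n\<bar>) ^ 2 = 1" by simp
    then have "(vv ^ 2) ^ nat \<bar>n\<bar> = 1" by (simp flip: power_mult add: mult.commute)
    moreover have "vv ^ 2 = qq ^ 4" by (simp add: vv_def flip: power_mult)
    ultimately have "qq ^ (4 * nat \<bar>n\<bar>) = 1" by (simp add: power_mult)
    then show False using qq_pow_ne_1[OF pos] by simp
  qed
qed simp

lemma vv_powi_eq_iff [simp]: "vv powi m = vv powi n \<longleftrightarrow> m = n"
proof -
  have "vv powi m = vv powi n \<longleftrightarrow> vv powi (m - n) = 1"
    by (simp add: power_int_diff)
  then show ?thesis by simp
qed

lemma qq_vv: "qq * qq = - vv" "qq * (qq * x) = - (vv * x)" "qq ^ 2 = - vv"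
  by (simp_all add: vv_def power2_eq_square)

lemma vv_squared_ne_1: "vv * vv \<noteq> 1"
  using vv_powi_eq_1_iff[of 2] by (simp add: power2_eq_square del: vv_powi_eq_1_iff)

lemma vv_ne_1: "vv \<noteq> 1"
  using vv_squared_ne_1 by auto

lemma vv_ne_inverse: "vv - inverse vv \<noteq> 0" "inverse vv - vv \<noteq> 0"
  using vv_squared_ne_1 by (auto simp: field_simps)

lemma vv_powi_add: "vv powi (m + n) = vv powi m * vv powi n"
  by (simp add: power_int_add)

lemma vv_powi_1: "vv powi (m + 1) = vv powi m * vv" "vv powi (m - 1) = vv powi m / vv"
  "vv powi (1 + m) = vv * vv powi m"
  by (simp_all add: power_int_add power_int_diff)

text \<open>
  The eigenvalues are indexed by all integers, with \<open>lam (- 1 - j) = lam j\<close>; in this form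
  the neighbours of \<open>lam j\<close> are \<open>lam (j \<plusminus> 1)\<close> also for \<open>j = 0\<close>.
\<close>

definition lam :: "int \<Rightarrow> Cq" where
  "lam j = (qq * vv powi j - inverse qq * vv powi (- j)) / (inverse vv - vv)"

lemma lam_reflect: "lam (- 1 - j) = lam j"
proof -
  have "qq * vv powi (- 1 - j) = - inverse qq * vv powi (- j)"
    using qq_vv by (simp add: power_int_diff power_int_minus field_simps)
  moreover have "inverse qq * vv powi (j + 1) = - qq * vv powi j"
    by (simp add: vv_powi_1 qq_vv field_simps)
  ultimately show ?thesis by (simp add: lam_def)
qed

text \<open>The factorization separates the two ways for values to coincide: equal indices, or
  indices swapped by the reflection j -> -1 - j.\<close>

lemma lam_diff:
  "lam j - lam m = qq * (vv powi j - vv powi m) * (1 - vv powi (- 1 - j - m)) / (inverse vv - vv)"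
proof -
  have *: "qq * vv powi (- 1 - j - m) = - inverse qq * (vv powi (- j) * vv powi (- m))"
    using qq_vv by (simp add: power_int_diff power_int_minus power_int_add field_simps)
  have "qq * (vv powi j - vv powi m) * (1 - vv powi (- 1 - j - m)) =
     qq * (vv powi j - vv powi m) - (vv powi j - vv powi m) * (qq * vv powi (- 1 - j - m))"
    by (simp add: algebra_simps)
  also have "\<dots> = qq * vv powi j - inverse qq * vv powi (- j) - (qq * vv powi m - inverse qq * vv powi (- m))"
    unfolding * by (simp add: power_int_minus algebra_simps)
  finally show ?thesis by (simp add: lam_def diff_divide_distrib)
qed

lemma lam_eq_iff: "lam j = lam m \<longleftrightarrow> j = m \<or> j + m = - 1"
proof -
  have "lam j = lam m \<longleftrightarrow> lam j - lam m = 0" by simp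
  also have "\<dots> \<longleftrightarrow> j = m \<or> vv powi (- 1 - j - m) = 1"
    unfolding lam_diff using vv_ne_inverse by auto
  also have "vv powi (- 1 - j - m) = 1 \<longleftrightarrow> j + m = - 1" by auto
  finally show ?thesis .
qed

section \<open>Quantum integers at q and the eigenvalues\<close>

lemma qint_qq_2: "qint qq 2 = qq + inverse qq" "qint qq 2 \<noteq> 0"
proof -
  have "qq * qq \<noteq> 1" using qq_pow_ne_1[of 2] by (simp add: power2_eq_square)
  then have *: "qq - inverse qq \<noteq> 0" by (auto simp: field_simps)
  then show **: "qint qq 2 = qq + inverse qq"
    by (simp add: qint_def power_int_minus field_simps power2_eq_square)
  show "qint qq 2 \<noteq> 0"
    unfolding ** using qq_vv vv_ne_1 by (auto simp: field_simps)
qed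

lemma lam_0: "lam 0 = 1 / qint qq 2"
proof -
  have "inverse vv - vv = (qq - inverse qq) * (qq + inverse qq)"
    using qq_vv by (simp add: field_simps) 
  moreover have "qq - inverse qq \<noteq> 0" "qq + inverse qq \<noteq> 0"
    using calculation vv_ne_inverse by auto
  ultimately show ?thesis by (simp add: lam_def qint_qq_2)
qed

lemma qq_powi_double: "qq powi (2 * m) = (- 1) powi m * vv powi m"
proof -
  have "qq powi (2 * m) = (qq ^ 2) powi m"
    by (simp add: power_int_mult)
  also have "\<dots> = ((- 1) * vv) powi m" by (simp add: qq_vv)
  finally show ?thesis by (simp only: power_int_mult_distrib)
qed

text \<open>Since v = -q^2, one has q^(2n+1) = (-1)^n v^n q, so the sign of the nonclassical
  eigenvalues is absorbed into powers of v.\<close>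

lemma lam_of_nat: "(- 1) ^ n * qint qq (2 * int n + 1) / qint qq 2 = lam (int n)"
proof -
  have 1: "qq powi (2 * int n + 1) = (- 1) ^ n * vv powi int n * qq"
    using qq_powi_double[of "int n"] by (simp add: power_int_add)
  have 2: "qq powi (- (2 * int n + 1)) = (- 1) ^ n * vv powi (- int n) * inverse qq"
    unfolding power_int_minus 1 by (simp add: power_inverse field_simps)
  have 3: "(qq - inverse qq) * qint qq 2 = inverse vv - vv"
    using qq_vv by (simp add: qint_qq_2 field_simps)
  have "(- 1) ^ n * qint qq (2 * int n + 1) / qint qq 2 =
     ((-1) ^ n * (- 1) ^ n) * (qq * vv powi int n - inverse qq * vv powi (- int n)) / ((qq - inverse qq) * qint qq 2)"
    unfolding qint_def[of qq "2 * int n + 1"] 1 2 by (simp add: algebra_simps)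
  then show ?thesis unfolding 3 lam_def by (simp flip: power_mult_distrib)
qed

lemma qint_qq_2_mult: "qint qq 2 * qint qq m = qint qq (m + 1) + qint qq (m - 1)"
proof -
  have *: "qq - inverse qq \<noteq> 0"
    using qq_pow_ne_1[of 2] by (auto simp: field_simps power2_eq_square)
  have "(qq + inverse qq) * (qq powi m - qq powi (- m)) =
    (qq powi (m + 1) - qq powi (- (m + 1))) + (qq powi (m - 1) - qq powi (- (m - 1)))"
    by (simp add: power_int_add power_int_diff power_int_minus field_simps)
  then show ?thesis
    unfolding qint_qq_2 unfolding qint_def by (simp flip: add_divide_distrib)
qed

text \<open>Multiplied by [2], the alternating sum D(m, m+1) telescopes. Its shift in the recursion
  for \<open>xdp\<close> thus turns lam j - lam 0 into lam j - lam m.\<close>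

lemma lam_D_coeff: "lam 0 + (- 1) ^ m * D_coeff m (m + 1) = lam (int m)"
proof -
  have D: "D_coeff m (m + 1) * qint qq 2 = qint qq (2 * int m + 1) - (- 1) ^ m" for m
  proof -
    \<comment> \<open>The number n of summands is decoupled from m so that induction can run; n = m
      is the wanted case.\<close>
    have "(\<Sum>i<n. (- 1) ^ i * qint qq (2 * int m - 2 * int i)) * qint qq 2 =
      qint qq (2 * int m + 1) - (- 1) ^ n * qint qq (2 * int m + 1 - 2 * int n)" for n
    proof (induction n)
      case (Suc n)
      have e: "2 * int m + 1 - 2 * int (Suc n) = 2 * int m - 2 * int n - 1" by simp
      have "qint qq 2 * qint qq (2 * int m - 2 * int n) =
        qint qq (2 * int m + 1 - 2 * int n) + qint qq (2 * int m - 2 * int n - 1)"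
        using qint_qq_2_mult[of "2 * int m - 2 * int n"] by (simp add: algebra_simps)
      then show ?case using Suc unfolding e by (simp add: algebra_simps)
    qed simp
    from this[of m] show ?thesis
      using qq_pow_ne_1[of 2] by (simp add: D_coeff_def qint_def algebra_simps power2_eq_square field_simps)
  qed
  have "lam (int m) = ((- 1) ^ m * qint qq (2 * int m + 1)) / qint qq 2"
    by (simp add: lam_of_nat)
  also have "\<dots> = ((- 1) ^ m * (D_coeff m (m + 1) * qint qq 2) + 1) / qint qq 2"
    unfolding D by (simp add: algebra_simps flip: power_mult_distrib)
  finally show ?thesis using qint_qq_2(2) by (simp add: lam_0 add_divide_distrib)
qed

section \<open>The summation formula\<close>

text \<open>\<open>q\<^sup>-\<^sup>n x\<^sup>(\<^sup>n\<^sup>)\<close> acts by \<open>tcoeff j n\<close> on an eigenvector with eigenvalue \<open>lam j\<close>.\<close>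

fun tcoeff :: "int \<Rightarrow> nat \<Rightarrow> Cq" where
  "tcoeff j 0 = 1"
| "tcoeff j (Suc n) =
     (- 1) ^ n / (qq * qint (qq ^ 2) (int n + 1)) * (lam j - lam (int n)) * tcoeff j n"

lemma vv_powi_double_ne_1: "vv powi (- int (2 * n + 2)) \<noteq> 1"
  by (subst vv_powi_eq_1_iff) simp

text \<open>
  With \<open>p = v\<^sup>-\<^sup>1\<close> this exhibits the sum of the \<open>tcoeff j n\<close> as the basic hypergeometric series
  \<open>\<^sub>2\<phi>\<^sub>1(p\<^sup>-\<^sup>j, p\<^sup>j\<^sup>+\<^sup>1; - p; p, p)\<close>, which is summed by the \<open>q\<close>-Chu-Vandermonde formula.
\<close>

lemma tcoeff_Suc:
  "tcoeff j (Suc n) = inverse vv * (1 - vv powi (j - int n)) * (1 - vv powi (- 1 - j - int n)) /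
     (1 - vv powi (- int (2 * n + 2))) * tcoeff j n"
proof -
  define N where "N = vv powi int n"
  define J where "J = vv powi j"
  have nz: "N \<noteq> 0" "J \<noteq> 0" by (simp_all add: N_def J_def)
  have w: "vv powi (- int (2 * n + 2)) = 1 / (N * N * vv * vv)"
  proof -
    have "- int (2 * n + 2) = - (int n + int n + 2)" by simp
    also have "vv powi \<dots> = 1 / (N * N * vv * vv)"
      unfolding power_int_minus power_int_add[OF disjI1, OF vv_nonzero]
      by (simp add: N_def power2_eq_square divide_inverse)
    finally show ?thesis .
  qed
  have q: "qint (qq ^ 2) (int n + 1) = (- 1) ^ n * (N * vv - 1 / (N * vv)) / (inverse vv - vv) * (- 1)"
  proof -
    have "(qq ^ 2) powi m = (- 1) powi m * vv powi m" for m
      by (simp add: qq_vv(3) flip: power_int_mult_distrib)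
    moreover have "(- 1 :: Cq) powi (int n + 1) = - ((- 1) ^ n)"
      by (simp add: power_int_add)
    moreover have "(- 1 :: Cq) powi (- (int n + 1)) = - ((- 1) ^ n)"
      unfolding power_int_minus by (cases "even n") (auto simp: power_int_add)
    moreover have "vv powi (int n + 1) = N * vv" "vv powi (- (int n + 1)) = 1 / (N * vv)"
      unfolding power_int_minus by (simp_all add: power_int_add N_def divide_inverse)
    ultimately have "qint (qq ^ 2) (int n + 1) =
      (- ((- 1) ^ n) * (N * vv) - (- ((- 1) ^ n)) * (1 / (N * vv))) / (qq ^ 2 - inverse (qq ^ 2))"
      unfolding qint_def by simp
    then show ?thesis by (simp add: qq_vv(3) algebra_simps)
  qed
  have l: "lam j - lam (int n) = qq * (J - N) * (1 - 1 / (vv * J * N)) / (inverse vv - vv)"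
    unfolding lam_diff by (simp add: J_def N_def power_int_diff power_int_minus divide_inverse)
  define P where "P = N * vv - 1 / (N * vv)"
  define Q where "Q = 1 - 1 / (N * N * vv * vv)"
  define R where "R = 1 - 1 / (vv * J * N)"
  have P: "P = N * vv * Q"
    using nz by (simp add: P_def Q_def field_simps)
  have J: "J - N = - N * (1 - J / N)"
    using nz by (simp add: field_simps)
  have "(- 1) ^ n / (qq * qint (qq ^ 2) (int n + 1)) * (lam j - lam (int n)) =
     - ((J - N) * R / P)"
    unfolding q l P_def[symmetric] R_def[symmetric] using vv_ne_inverse(2) by simp
  also have "\<dots> = inverse vv * (1 - J / N) * R / Q"
    unfolding P J using nz by (simp add: divide_inverse mult_ac)
  finally show ?thesis
    unfolding tcoeff.simps w Q_def R_def
    by (simp add: J_def N_def power_int_diff power_int_minus divide_inverse)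
qed

text \<open>Both sides agree at n = 0 and have the same ratio of consecutive terms. Expressing the
  summand for j + 1 through that for j makes the telescoping an identity of rational
  functions.\<close>

lemma tcoeff_shift:
  "tcoeff (j + 1) (Suc n) = - (vv powi j) * (1 - vv powi (- 1 - j - int n)) * (1 - vv powi (- 2 - j - int n)) /
     (1 - vv powi (- int (2 * n + 2))) * tcoeff j n"
proof (induction n)
  case 0
  have "1 - vv powi (j + 1) = - (vv powi j) * vv * (1 - vv powi (- 1 - j))"
    by (simp add: power_int_add power_int_diff power_int_minus field_simps)
  then show ?case unfolding tcoeff_Suc by simp
next
  case (Suc n)
  have e: "j + 1 - int (Suc n) = j - int n" "- 1 - (j + 1) - int (Suc n) = - 2 - j - int (Suc n)"
    "- 2 - j - int n = - 1 - j - int (Suc n)"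
    by simp_all
  show ?case
    unfolding tcoeff_Suc[of "j + 1" "Suc n"] tcoeff_Suc[of j n] Suc e by (simp add: mult_ac)
qed

text \<open>Creative telescoping: the difference of the \<open>n\<close>-th summands is a difference of right-hand sides.\<close>

lemma tcoeff_sum_shift:
  "(\<Sum>k\<le>n. tcoeff (j + 1) k) - vv powi (- 1 - j) * (\<Sum>k\<le>n. tcoeff j k) =
     vv powi int n * (1 - vv powi (- 1 - j - int n)) * tcoeff j n"
proof (induction n)
  case (Suc n)
  define N where "N = vv powi int n"
  define J where "J = vv powi j"
  define d where "d = 1 / (1 - vv powi (- int (2 * n + 2)))"
  have nz: "N \<noteq> 0" "J \<noteq> 0" by (simp_all add: N_def J_def)
  have w: "vv powi (- int (2 * n + 2)) = 1 / (N * N * vv * vv)"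
  proof -
    have "- int (2 * n + 2) = - (int n + int n + 2)" by simp
    also have "vv powi \<dots> = 1 / (N * N * vv * vv)"
      unfolding power_int_minus power_int_add[OF disjI1, OF vv_nonzero]
      by (simp add: N_def power2_eq_square divide_inverse)
    finally show ?thesis .
  qed
  have ne: "N * N * vv * vv \<noteq> 1"
    using vv_powi_double_ne_1[of n] nz unfolding w by auto
  have e: "vv powi (- 1 - j) = 1 / (vv * J)" "vv powi (- 1 - j - int n) = 1 / (vv * J * N)"
    "vv powi (- 2 - j - int n) = 1 / (vv * vv * J * N)"
    "vv powi (- 1 - j - int (Suc n)) = 1 / (vv * vv * J * N)"
    "vv powi (int (Suc n)) = N * vv" "vv powi (j - int n) = J / N"
  proof -
    have "- 1 - j - int (Suc n) = - 2 - j - int n" by simp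
    then show "vv powi (- 1 - j - int (Suc n)) = 1 / (vv * vv * J * N)"
      "vv powi (- 2 - j - int n) = 1 / (vv * vv * J * N)"
      by (simp_all only:) (simp_all add: power_int_add power_int_diff power_int_minus N_def J_def power2_eq_square field_simps)
  qed (simp_all add: power_int_add power_int_diff power_int_minus N_def J_def field_simps)
  \<comment> \<open>The increment identity with the common factor \<open>tcoeff j n\<close> removed,
    rational in J, N and v.\<close>
  have "- J * (1 - 1 / (vv * J * N)) * (1 - 1 / (vv * vv * J * N)) * d
      - 1 / (vv * J) * (1 / vv * (1 - J / N) * (1 - 1 / (vv * J * N)) * d)
      = N * vv * (1 - 1 / (vv * vv * J * N)) * (1 / vv * (1 - J / N) * (1 - 1 / (vv * J * N)) * d)
      - N * (1 - 1 / (vv * J * N))"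
    unfolding d_def w using nz ne by (simp add: divide_simps) (simp add: algebra_simps)
  note key = this
  have "tcoeff (j + 1) (Suc n) - vv powi (- 1 - j) * tcoeff j (Suc n) =
      vv powi int (Suc n) * (1 - vv powi (- 1 - j - int (Suc n))) * tcoeff j (Suc n)
      - vv powi int n * (1 - vv powi (- 1 - j - int n)) * tcoeff j n"
    using arg_cong[OF key, of "\<lambda>z. z * tcoeff j n"]
    unfolding tcoeff_shift tcoeff_Suc[of j n] e N_def[symmetric] J_def[symmetric] d_def
    by (simp add: algebra_simps divide_inverse)
  moreover have "S + x - c * (S' + y) = r'"
    if "S - c * S' = r" "x - c * y = r' - r" for S S' x y c r r' :: Cq
  proof -
    have "S + x - c * (S' + y) = (S - c * S') + (x - c * y)" by (simp add: algebra_simps)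
    then show ?thesis using that by simp
  qed
  ultimately show ?case
    unfolding sum.atMost_Suc using Suc.IH by blast
qed simp

text \<open>The series terminates: the coefficient of index m + 1 contains the factor lam m - lam
  m.\<close>

lemma tcoeff_eq_0: "m < n \<Longrightarrow> tcoeff (int m) n = 0"
proof (induction n)
  case (Suc n)
  then show ?case by (cases "n = m") auto
qed simp

text \<open>The division is exact, as j (j + 1) is even. Negative indices are included to match the
  reflection symmetry of \<open>lam\<close>.\<close>

definition tau :: "int \<Rightarrow> Cq" where
  "tau j = vv powi (- (j * (j + 1) div 2))"

lemma tau_Suc: "tau (j + 1) = vv powi (- 1 - j) * tau j"
proof -
  have "(j + 1) * (j + 1 + 1) = j * (j + 1) + (j + 1) * 2" by (simp add: algebra_simps)
  then have "(j + 1) * (j + 1 + 1) div 2 = j * (j + 1) div 2 + (j + 1)"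
    by simp
  then show ?thesis by (simp add: tau_def flip: vv_powi_add)
qed

lemma tau_nonzero [simp]: "tau j \<noteq> 0"
  by (simp add: tau_def)

lemma tau_reflect: "tau (- 1 - j) = tau j"
  by (simp add: tau_def algebra_simps)

text \<open>For m < n the boundary term of \<open>tcoeff_sum_shift\<close> vanishes, so the sum
  obeys the same recursion in m as \<open>tau\<close>.\<close>

lemma tcoeff_sum: "m \<le> n \<Longrightarrow> (\<Sum>k\<le>n. tcoeff (int m) k) = tau (int m)"
proof (induction m arbitrary: n)
  case 0
  have "(\<Sum>k\<le>n. tcoeff 0 k) = (\<Sum>k\<in>{0}. tcoeff 0 k)"
    using tcoeff_eq_0[of 0] by (intro sum.mono_neutral_right) auto
  then show ?case by (simp add: tau_def)
next
  case (Suc m)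
  have "(\<Sum>k\<le>n. tcoeff (int m + 1) k) = vv powi (- 1 - int m) * (\<Sum>k\<le>n. tcoeff (int m) k)"
    using tcoeff_sum_shift[of "int m" n] tcoeff_eq_0[of m n] Suc.prems by simp
  also have "(\<Sum>k\<le>n. tcoeff (int m) k) = tau (int m)"
    using Suc by simp
  also have "vv powi (- 1 - int m) * tau (int m) = tau (int m + 1)"
    by (simp add: tau_Suc)
  finally show ?case by (simp add: add.commute)
qed

section \<open>Linear algebra\<close>

lemma linear_simps:
  assumes "Vector_Spaces.linear s s g"
  shows "g (x + y) = g x + g y" "g (x - y) = g x - g y" "g (- x) = - g x" "g (s c x) = s c (g x)" "g 0 = 0"
proof -
  interpret Vector_Spaces.linear s s g by fact
  show "g (x + y) = g x + g y" "g (x - y) = g x - g y" "g (- x) = - g x" "g (s c x) = s c (g x)" "g 0 = 0"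
    by (auto simp: add diff neg scale zero)
qed

lemma linear_eq_if_eq_on_spanning:
  assumes "Vector_Spaces.linear s1 s2 g" "Vector_Spaces.linear s1 s2 h"
    and "module.span s1 S = UNIV" "\<And>x. x \<in> S \<Longrightarrow> g x = h x"
  shows "g = h"
proof
  fix x
  interpret Vector_Spaces.linear s1 s2 g by fact
  interpret vector_space_pair s1 s2 by unfold_locales
  show "g x = h x"
    by (rule linear_eq_on_span[OF assms(1,2,4)]) (use assms(3) in auto)
qed

definition eig :: "(Cq \<Rightarrow> 'w::ab_group_add \<Rightarrow> 'w) \<Rightarrow> ('w \<Rightarrow> 'w) \<Rightarrow> Cq \<Rightarrow> 'w set" where
  "eig s B c = {x. B x = s c x}"

text \<open>A maximal independent subset of the union of the eigenspaces is already a basis.\<close>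

lemma diagonalizable_with_if_eig_span:
  assumes "vector_space s" "module.span s (\<Union>c\<in>S. eig s B c) = UNIV"
  shows "diagonalizable_with s S B"
proof -
  interpret vector_space s by fact
  obtain C where C: "C \<subseteq> (\<Union>c\<in>S. eig s B c)" "independent C" "(\<Union>c\<in>S. eig s B c) \<subseteq> span C"
    by (rule maximal_independent_subset)
  then have "span C = UNIV"
    using assms(2) span_minimal[OF C(3)] by auto
  then show ?thesis
    using C unfolding diagonalizable_with_def is_basis_def eig_def by blast
qed

lemma finite_basis:
  assumes "vector_space s" "finite A" "module.span s A = UNIV" "is_basis s B"
  shows "finite B"
proof -
  interpret vector_space s by fact
  show ?thesis
    using assms independent_span_bound[of A B] by (simp add: is_basis_def)
qed

text \<open>Compare coefficients of x in the eigenbasis. This serves to bound weights and to prove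
  injectivity from nonzero eigenvalues.\<close>

lemma eigenvalue_of_basis:
  assumes "Vector_Spaces.linear s s g" "is_basis s B" "\<And>w. w \<in> B \<Longrightarrow> g w = s (h w) w"
    and "g x = s c x" "c \<notin> h ` B"
  shows "x = 0"
proof -
  interpret Vector_Spaces.linear s s g by fact
  have ind: "vs1.independent B" and "x \<in> vs1.span B"
    using assms(2) by (auto simp: is_basis_def)
  then obtain t r where t: "finite t" "t \<subseteq> B" and x: "x = (\<Sum>a\<in>t. s (r a) a)"
    unfolding vs1.span_explicit by auto
  have "g x = (\<Sum>a\<in>t. s (r a * h a) a)"
    unfolding x sum scale using t assms(3) by (intro sum.cong) auto
  moreover have "s c x = (\<Sum>a\<in>t. s (r a * c) a)"
    unfolding x vs1.scale_sum_right by (simp add: mult.commute)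
  ultimately have "(\<Sum>a\<in>t. s (r a * h a - r a * c) a) = 0"
    using assms(4) by (simp add: vs1.scale_left_diff_distrib sum_subtractf)
  then have "r a * h a - r a * c = 0" if "a \<in> t" for a
    using vs1.independentD[OF ind t, of "\<lambda>a. r a * h a - r a * c" a] that by blast
  then have "r a = 0" if "a \<in> t" for a
    using that assms(5) t by (auto simp: algebra_simps)
  then show ?thesis unfolding x by simp
qed

text \<open>On the sum of the eigenspaces for \<open>S'\<close> the operator B - c is invertible, so
  subtracting from y a preimage of B y - c y leaves an eigenvector for c.\<close>

lemma eig_span_if_triangular:
  assumes "Vector_Spaces.linear s s B" "c \<in> S" "S' \<subseteq> S - {c}"
    and "B y - s c y \<in> module.span s (\<Union>c\<in>S'. eig s B c)"
  shows "y \<in> module.span s (\<Union>c\<in>S. eig s B c)"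
proof -
  interpret Vector_Spaces.linear s s B by fact
  let ?E = "\<lambda>S. vs1.span (\<Union>c\<in>S. eig s B c)"
  have mono: "?E S' \<subseteq> ?E S"
    using assms(3) by (intro vs1.span_mono) auto
  have "\<exists>z\<in>?E S. B z - s c z = w" if "w \<in> ?E S'" for w
    using that
  proof (induction rule: vs1.span_induct_alt)
    case base
    show ?case by (rule bexI[of _ 0]) (auto simp: vs1.span_zero zero)
  next
    case (step d x w)
    then obtain c' where c': "c' \<in> S'" "B x = s c' x" by (auto simp: eig_def)
    obtain z where z: "z \<in> ?E S" "B z - s c z = w" using step by auto
    have "x \<in> ?E S"
      using step(1) mono vs1.span_base by blast
    \<comment> \<open>With this r, the vector \<open>s r x\<close> is a preimage of
      \<open>s d x\<close> under B - c.\<close>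
    moreover define r where "r = d / (c' - c)"
    have "c' - c \<noteq> 0" using c' assms(3) by auto
    then have "r * (c' - c) = d" by (simp add: r_def)
    then have "r * c' - c * r = d" by (simp add: algebra_simps)
    then have "B (s r x) - s c (s r x) = s d x"
      using c' by (simp add: scale flip: vs1.scale_left_diff_distrib)
    ultimately show ?case
      using z by (intro bexI[of _ "s r x + z"])
        (auto simp: vs1.span_add vs1.span_scale add vs1.scale_right_distrib algebra_simps)
  qed
  then obtain z where z: "z \<in> ?E S" "B z - s c z = B y - s c y"
    using assms(4) by metis
  then have "y - z \<in> eig s B c"
    by (auto simp: eig_def diff vs1.scale_right_diff_distrib algebra_simps)
  then have "y - z \<in> ?E S"
    using assms(2) by (intro vs1.span_base) auto
  then have "(y - z) + z \<in> ?E S"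
    using z vs1.span_add by blast
  then show ?thesis by simp
qed

lemma bij_if_eig_nonzero:
  assumes "Vector_Spaces.linear s s g" "module.span s (\<Union>c\<in>-{0}. eig s g c) = UNIV"
  shows "bij g"
proof -
  interpret Vector_Spaces.linear s s g by fact
  interpret vector_space_pair s s by unfold_locales
  have "diagonalizable_with s (- {0}) g"
    using assms(2) vs1.vector_space_axioms by (rule diagonalizable_with_if_eig_span[rotated])
  then obtain C where C: "is_basis s C" "\<forall>w\<in>C. \<exists>c\<in>-{0}. g w = s c w"
    unfolding diagonalizable_with_def by auto
  then obtain h where h: "\<And>w. w \<in> C \<Longrightarrow> h w \<noteq> 0 \<and> g w = s (h w) w"
    using bchoice[of C "\<lambda>w c. c \<noteq> 0 \<and> g w = s c w"] by auto
  have "inj g"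
  proof (rule injI)
    fix x y assume "g x = g y"
    then have "g (x - y) = s 0 (x - y)" by (simp add: diff)
    then have "x - y = 0"
      using h by (intro eigenvalue_of_basis[OF assms(1) C(1), of h _ 0]) auto
    then show "x = y" by simp
  qed
  moreover have "surj g"
  proof -
    have "x \<in> range g" if "x \<in> C" for x
      using h[OF that] by (intro image_eqI[of _ _ "s (1 / h x) x"]) (auto simp: scale)
    then have "vs1.span C \<subseteq> range g"
      by (intro vs1.span_minimal subspace_image) auto
    then show ?thesis using C(1) by (auto simp: is_basis_def)
  qed
  ultimately show ?thesis by (simp add: bij_def)
qed

section \<open>Modules over the quantum group of rank one\<close>

definition wt :: "(Cq \<Rightarrow> 'v::ab_group_add \<Rightarrow> 'v) \<Rightarrow> ('v \<Rightarrow> 'v) \<Rightarrow> int \<Rightarrow> 'v set" where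
  "wt s K m = eig s K (vv powi m)"

lemma vv_powi_twice: "vv powi (n * 2) = vv powi n * vv powi n" "vv powi (2 * n) = vv powi n * vv powi n"
  using vv_powi_add[of n n] by (simp_all add: mult.commute)

locale sl2_module = vector_space s
  for s :: "Cq \<Rightarrow> 'v::ab_group_add \<Rightarrow> 'v" +
  fixes E F K K' :: "'v \<Rightarrow> 'v"
  assumes linear: "Vector_Spaces.linear s s E" "Vector_Spaces.linear s s F"
      "Vector_Spaces.linear s s K" "Vector_Spaces.linear s s K'"
    and K'_K: "K' (K x) = x"
    and K_E: "K (E x) = s (vv powi 2) (E (K x))"
    and K_F: "K (F x) = s (vv powi (- 2)) (F (K x))"
    and E_F: "E (F x) = F (E x) + s (inverse (vv - inverse vv)) (K x - K' x)"
begin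

text \<open>The action of b on V tensor N, read on V: the last summand comes from k^-1 tensor b, as
  b acts on N by 1/[2].\<close>

definition B :: "'v \<Rightarrow> 'v" where
  "B x = F x + s (inverse vv) (E (K' x)) + s (1 / qint qq 2) (K' x)"

lemma lin [simp]:
  "E (x + y) = E x + E y" "E (s c x) = s c (E x)" "E 0 = 0"
  "F (x + y) = F x + F y" "F (s c x) = s c (F x)" "F 0 = 0"
  "K (x + y) = K x + K y" "K (s c x) = s c (K x)" "K 0 = 0"
  "K' (x + y) = K' x + K' y" "K' (s c x) = s c (K' x)" "K' 0 = 0"
proof -
  have "g (x + y) = g x + g y \<and> g (s c x) = s c (g x) \<and> g 0 = 0"
    if "Vector_Spaces.linear s s g" for g x y c
  proof -
    interpret Vector_Spaces.linear s s g by fact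
    show ?thesis by (auto simp: add scale zero)
  qed
  with linear show "E (x + y) = E x + E y" "E (s c x) = s c (E x)" "E 0 = 0"
  "F (x + y) = F x + F y" "F (s c x) = s c (F x)" "F 0 = 0"
  "K (x + y) = K x + K y" "K (s c x) = s c (K x)" "K 0 = 0"
  "K' (x + y) = K' x + K' y" "K' (s c x) = s c (K' x)" "K' 0 = 0"
    by blast+
qed

lemma linear_B: "Vector_Spaces.linear s s B"
  unfolding Vector_Spaces.linear_iff using vector_space_axioms
  by (auto simp: B_def scale_right_distrib mult.commute)

section \<open>Weight vectors\<close>

lemma wt_E: "x \<in> wt s K m \<Longrightarrow> E x \<in> wt s K (m + 2)"
  by (simp add: wt_def eig_def K_E vv_powi_add)

lemma wt_F: "x \<in> wt s K m \<Longrightarrow> F x \<in> wt s K (m - 2)"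
  using vv_powi_add[of m "- 2"] by (simp add: wt_def eig_def K_F)

lemma wt_E_pow: "x \<in> wt s K m \<Longrightarrow> (E ^^ n) x \<in> wt s K (m + 2 * int n)"
proof (induction n)
  case (Suc n)
  have "m + 2 * int (Suc n) = m + 2 * int n + 2" by simp
  then show ?case using wt_E Suc by (simp only: funpow.simps o_apply)
qed simp

lemma wt_K': "x \<in> wt s K m \<Longrightarrow> K' x = s (vv powi (- m)) x"
proof -
  assume "x \<in> wt s K m"
  then have "K' (K x) = s (vv powi m) (K' x)" by (simp add: wt_def eig_def)
  then have "s (vv powi (- m)) x = s (vv powi (- m)) (s (vv powi m) (K' x))"
    by (simp add: K'_K)
  also have "\<dots> = K' x"
    by (simp flip: vv_powi_add)
  finally show ?thesis by simp
qed

text \<open>It merges the weight bracket of a new commutator with the accumulated scalar in the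
  induction step of \<open>E_pow_F\<close>.\<close>

lemma qint_vv_add: "qint vv (m + 2 * n) + qint vv n * qint vv (m + n - 1) = qint vv (n + 1) * qint vv (m + n)"
proof -
  define P where "P = vv powi m"
  define N where "N = vv powi n"
  have nz: "P \<noteq> 0" "N \<noteq> 0" by (auto simp: P_def N_def)
  have d: "vv - inverse vv \<noteq> 0" by (rule vv_ne_inverse)
  have e: "vv powi (m + 2 * n) = P * N * N" "vv powi (- (m + 2 * n)) = 1 / (P * N * N)"
    "vv powi (m + n - 1) = P * N / vv" "vv powi (- (m + n - 1)) = vv / (P * N)"
    "vv powi (n + 1) = N * vv" "vv powi (- (n + 1)) = 1 / (N * vv)"
    "vv powi (m + n) = P * N" "vv powi (- (m + n)) = 1 / (P * N)"
    "vv powi n = N" "vv powi (- n) = 1 / N"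
    unfolding mult_2 power_int_minus
    by (simp_all add: P_def N_def power_int_add power_int_diff vv_powi_twice field_simps)
  have clear: "x / (vv - inverse vv) + y / (vv - inverse vv) * (z / (vv - inverse vv)) =
      x' / (vv - inverse vv) * (y' / (vv - inverse vv))"
    if "x * (vv - inverse vv) + y * z = x' * y'" for x y z x' y'
  proof -
    have "x / d + y / d * (z / d) = x' / d * (y' / d)" if "x * d + y * z = x' * y'" "d \<noteq> 0" for d
      using that by (simp add: divide_simps)
    then show ?thesis using that d by blast
  qed
  have "(P * N * N - 1 / (P * N * N)) * (vv - inverse vv) + (N - 1 / N) * (P * N / vv - vv / (P * N)) =
    (N * vv - 1 / (N * vv)) * (P * N - 1 / (P * N))"
    using nz by (simp add: field_simps)
  then have "(P * N * N - 1 / (P * N * N)) / (vv - inverse vv) +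
    (N - 1 / N) / (vv - inverse vv) * ((P * N / vv - vv / (P * N)) / (vv - inverse vv)) =
    (N * vv - 1 / (N * vv)) / (vv - inverse vv) * ((P * N - 1 / (P * N)) / (vv - inverse vv))"
    by (rule clear)
  then show ?thesis unfolding qint_def e .
qed

lemma E_F_wt:
  assumes "x \<in> wt s K m"
  shows "E (F x) = F (E x) + s (qint vv m) x"
proof -
  have "K x = s (vv powi m) x" using assms by (simp add: wt_def eig_def)
  then show ?thesis
    unfolding E_F wt_K'[OF assms]
    by (simp add: qint_def divide_inverse mult.commute flip: scale_left_diff_distrib)
qed

text \<open>Moving F leftwards through the power of E produces one weight bracket per factor, and
  these brackets sum to a product.\<close>

lemma E_pow_F:
  assumes "x \<in> wt s K m"
  shows "(E ^^ Suc n) (F x) = F ((E ^^ Suc n) x) + s (qint vv (int n + 1) * qint vv (m + int n)) ((E ^^ n) x)"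
proof (induction n)
  case 0
  have "qint vv 1 = 1" using vv_ne_inverse by (simp add: qint_def)
  then show ?case using E_F_wt[OF assms] by simp
next
  case (Suc n)
  let ?y = "(E ^^ Suc n) x"
  have y: "?y \<in> wt s K (m + 2 * (int n + 1))"
    using wt_E_pow[OF assms, of "Suc n"] by (simp only: of_nat_Suc add.commute[of 1])
  have "(E ^^ Suc (Suc n)) (F x) = E (F ?y) + s (qint vv (int n + 1) * qint vv (m + int n)) ?y"
    unfolding funpow.simps(2)[of "Suc n"] o_apply Suc by simp
  also have "\<dots> = F ((E ^^ Suc (Suc n)) x) +
      s (qint vv (m + 2 * (int n + 1)) + qint vv (int n + 1) * qint vv (m + (int n + 1) - 1)) ?y"
    unfolding E_F_wt[OF y] by (simp add: scale_left_distrib)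
  finally show ?case
    unfolding qint_vv_add by (simp add: algebra_simps)
qed

text \<open>
  Conjugation by the \<open>q\<close>-exponential \<open>\<Phi> = \<Sum>\<^sub>n c\<^sub>n E\<^sup>n\<close> makes \<open>B\<close> triangular, with \<open>lam m\<close>
  on the diagonal block of weight \<open>m\<close>.
\<close>

fun phi_coeff :: "nat \<Rightarrow> Cq" where
  "phi_coeff 0 = 1"
| "phi_coeff (Suc n) = qq * vv powi (- int n) / qint vv (int n + 1) * phi_coeff n"

lemma qint_vv_nonzero: "m \<noteq> 0 \<Longrightarrow> qint vv m \<noteq> 0"
  using vv_ne_inverse by (simp add: qint_def)

lemma phi_coeff_Suc: "phi_coeff (Suc n) * qint vv (int n + 1) = qq * vv powi (- int n) * phi_coeff n"
  using qint_vv_nonzero[of "int n + 1"] by simp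

definition Phi :: "nat \<Rightarrow> 'v \<Rightarrow> 'v" where
  "Phi N x = (\<Sum>n\<le>N. s (phi_coeff n) ((E ^^ n) x))"

lemma B_E_pow:
  assumes "x \<in> wt s K m"
  shows "B ((E ^^ n) x) = F ((E ^^ n) x) + s (vv powi (- 1 - m - 2 * int n)) ((E ^^ Suc n) x)
     + s (vv powi (- m - 2 * int n) / qint qq 2) ((E ^^ n) x)"
  unfolding B_def wt_K'[OF wt_E_pow[OF assms]]
  by (simp add: power_int_diff power_int_minus field_simps power_int_add)

text \<open>This compares coefficients of E^n x in \<open>Phi_B_aux\<close>: on the left the raising
  term from degree n - 1 and the K' term, on the right the diagonal scalar and the boundary
  term.\<close>

lemma phi_coeff_identity:
  "qint vv n * inverse qq * vv powi (- m - n) + vv powi (- m - 2 * n) / qint qq 2 =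
     lam m + qq * vv powi (- n) * qint vv (m + n)"
proof -
  define P where "P = vv powi m"
  define N where "N = vv powi n"
  define d where "d = inverse vv - vv"
  have nz: "P \<noteq> 0" "N \<noteq> 0" "d \<noteq> 0" using vv_ne_inverse by (auto simp: P_def N_def d_def)
  have d: "vv - inverse vv = - d" by (simp add: d_def)
  have e: "vv powi (- m - n) = 1 / (P * N)" "vv powi (- m - 2 * n) = 1 / (P * N * N)"
    "vv powi (- n) = 1 / N" "vv powi (m + n) = P * N" "vv powi (- (m + n)) = 1 / (P * N)"
    "vv powi n = N" "vv powi m = P" "vv powi (- m) = 1 / P"
    unfolding mult_2 power_int_minus
    by (simp_all add: P_def N_def power_int_add power_int_diff power_int_minus vv_powi_twice field_simps)
  have l0: "1 / qint qq 2 = (qq - inverse qq) / d"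
    unfolding lam_0[symmetric] by (simp add: lam_def d_def)
  have l1: "r / qint qq 2 = r * ((qq - inverse qq) / d)" for r
    unfolding l0[symmetric] by simp
  have "- (N - 1 / N) * inverse qq * (1 / (P * N)) + 1 / (P * N * N) * (qq - inverse qq) =
    qq * P - inverse qq * (1 / P) + qq * (1 / N) * (- (P * N - 1 / (P * N)))" (is "?L = ?R")
    using nz by (simp add: field_simps)
  then have "(N - 1 / N) / (- d) * inverse qq * (1 / (P * N)) + 1 / (P * N * N) * ((qq - inverse qq) / d) =
    (qq * P - inverse qq * (1 / P)) / d + qq * (1 / N) * ((P * N - 1 / (P * N)) / (- d))"
    (is "?l = ?r")
  proof -
    assume *: "?L = ?R"
    have neg: "r / (- d) = (- r) / d" for r by simp
    have "?l = ?L / d" unfolding neg by (simp only: add_divide_distrib) simp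
    also have "\<dots> = ?r" unfolding * neg by (simp only: add_divide_distrib) simp
    finally show ?thesis .
  qed
  then show ?thesis
    unfolding qint_def[of vv] lam_def e d d_def[symmetric] l1 .
qed

text \<open>The last summand is the error of cutting the q-exponential at N. In passing to N + 1,
  its \<open>E ^^ N\<close> part becomes the commutator of F with the new power of E, by the
  recursion for \<open>phi_coeff\<close>; the other part is handled by
  \<open>phi_coeff_identity\<close>.\<close>

lemma Phi_B_aux:
  assumes "x \<in> wt s K m"
  shows "B (Phi N x) = Phi N (F x) + s (lam m) (Phi N x) +
     s (phi_coeff N) (s (vv powi (- 1 - m - 2 * int N)) ((E ^^ Suc N) x)
       + s (qq * vv powi (- int N) * qint vv (m + int N)) ((E ^^ N) x))"
proof (induction N)
  case 0
  have "vv powi (- m) / qint qq 2 = lam m + qq * qint vv m"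
    using phi_coeff_identity[of 0 m] by (simp add: qint_def)
  then show ?case
    using B_E_pow[OF assms, of 0] by (simp add: Phi_def scale_left_distrib)
next
  case (Suc N)
  define c where "c = phi_coeff N"
  define c' where "c' = phi_coeff (Suc N)"
  define y where "y = (E ^^ Suc N) x"
  define z where "z = (E ^^ N) x"
  have cc: "c' * qint vv (int N + 1) = qq * vv powi (- int N) * c"
    unfolding c_def c'_def by (rule phi_coeff_Suc)
  have Phi: "Phi (Suc N) w = Phi N w + s c' ((E ^^ Suc N) w)" for w
    by (simp add: Phi_def c'_def del: funpow.simps phi_coeff.simps)
  have "c * vv powi (- 1 - m - 2 * int N) = c' * (qint vv (int N + 1) * inverse qq * vv powi (- m - (int N + 1)))"
  proof -
    have "- 1 - m - 2 * int N = (- int N) + (- m - (int N + 1))" by simp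
    then have "c * vv powi (- 1 - m - 2 * int N) = c * (vv powi (- int N) * vv powi (- m - (int N + 1)))"
      by (simp only: vv_powi_add)
    also have "\<dots> = (qq * vv powi (- int N) * c) * (inverse qq * vv powi (- m - (int N + 1)))"
      by simp
    finally show ?thesis unfolding cc[symmetric] by (simp only: mult.assoc)
  qed
  then have scalar: "c * vv powi (- 1 - m - 2 * int N) + c' * (vv powi (- m - 2 * int (Suc N)) / qint qq 2) =
    c' * lam m + c' * (qq * vv powi (- int (Suc N)) * qint vv (m + int (Suc N)))"
    using phi_coeff_identity[of "int N + 1" m]
    by (simp only: of_nat_Suc add.commute[of 1] flip: distrib_left)
  have "B (Phi (Suc N) x) = B (Phi N x) + s c' (B y)"
    using linear_B by (auto simp: Phi Vector_Spaces.linear_iff y_def)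
  also have "\<dots> = Phi N (F x) + s (lam m) (Phi N x) +
     (s (c * vv powi (- 1 - m - 2 * int N)) y + s (c * (qq * vv powi (- int N) * qint vv (m + int N))) z) +
     (s c' (F y) + s (c' * vv powi (- 1 - m - 2 * int (Suc N))) ((E ^^ Suc (Suc N)) x) +
      s (c' * (vv powi (- m - 2 * int (Suc N)) / qint qq 2)) y)"
    unfolding Suc y_def B_E_pow[OF assms] c_def[symmetric] z_def
    by (simp only: scale_right_distrib scale_scale)
  also have "c * (qq * vv powi (- int N) * qint vv (m + int N)) = (qq * vv powi (- int N) * c) * qint vv (m + int N)"
    by (simp only: mult_ac)
  also have "\<dots> = c' * (qint vv (int N + 1) * qint vv (m + int N))"
    unfolding cc[symmetric] by (simp only: mult.assoc)
  finally have B: "B (Phi (Suc N) x) = Phi N (F x) + s (lam m) (Phi N x) +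
     (s (c * vv powi (- 1 - m - 2 * int N)) y + s (c' * (qint vv (int N + 1) * qint vv (m + int N))) z) +
     (s c' (F y) + s (c' * vv powi (- 1 - m - 2 * int (Suc N))) ((E ^^ Suc (Suc N)) x) +
      s (c' * (vv powi (- m - 2 * int (Suc N)) / qint qq 2)) y)" .
  have F: "Phi (Suc N) (F x) = Phi N (F x) + s c' (F y) + s (c' * (qint vv (int N + 1) * qint vv (m + int N))) z"
    unfolding Phi E_pow_F[OF assms] y_def z_def by (simp only: scale_right_distrib scale_scale add.assoc)
  have reorder: "p + s l p' + (s a y + r) + (t + u + s a' y) = (p + t + r) + s l (p' + s c' y) + (u + s (c' * h) y)"
    if "a + a' = c' * l + c' * h" for p p' r t u a a' l h
  proof -
    have "s a y + s a' y = s (c' * l) y + s (c' * h) y"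
      using that by (simp only: flip: scale_left_distrib)
    then show ?thesis
      by (simp add: scale_right_distrib algebra_simps)
  qed
  show ?case
    unfolding B F
    unfolding reorder[OF scalar] Phi[of x] c'_def[symmetric] y_def[symmetric]
    by (simp only: scale_right_distrib scale_scale)
qed

lemma Phi_B:
  assumes "x \<in> wt s K m" "(E ^^ N) x = 0"
  shows "B (Phi N x) - s (lam m) (Phi N x) = Phi N (F x)"
  using Phi_B_aux[OF assms(1), of N] assms(2) by simp

text \<open>
  Within one parity class of weights the eigenvalues \<open>lam m\<close> are distinct, so that the triangular form
  can be diagonalized.
\<close>

lemma Phi_in_eig_span:
  assumes bound: "\<And>m x. x \<in> wt s K m \<Longrightarrow> \<bar>m\<bar> > int N \<Longrightarrow> x = 0"
    and "x \<in> wt s K m"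
  shows "Phi (Suc N) x \<in> span (\<Union>c\<in>lam ` {l. l \<le> m \<and> even (m - l)}. eig s B c)"
  using assms(2)
proof (induction "nat (m + int N + 1)" arbitrary: m x rule: less_induct)
  case less
  have zero: "(E ^^ n) 0 = 0" for n
    by (induction n) auto
  show ?case
  proof (cases "m < - int N")
    case True
    then have "x = 0" using bound less.prems by auto
    then have "Phi (Suc N) x = 0" by (simp add: Phi_def zero del: funpow.simps)
    then show ?thesis by (simp add: span_zero)
  next
    case False
    \<comment> \<open>As m >= -N, the weight m + 2 (N + 1) exceeds N.\<close>
    have "(E ^^ Suc N) x \<in> wt s K (m + 2 * int (Suc N))"
      by (rule wt_E_pow[OF less.prems])
    then have "(E ^^ Suc N) x = 0"
      by (rule bound) (use False in simp)
    then have *: "B (Phi (Suc N) x) - s (lam m) (Phi (Suc N) x) = Phi (Suc N) (F x)"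
      by (rule Phi_B[OF less.prems])
    have in_span: "B (Phi (Suc N) x) - s (lam m) (Phi (Suc N) x) \<in>
        span (\<Union>c\<in>lam ` {l. l \<le> m - 2 \<and> even (m - 2 - l)}. eig s B c)"
      unfolding * using False by (intro less.hyps wt_F less.prems) auto
    have sub: "lam ` {l. l \<le> m - 2 \<and> even (m - 2 - l)} \<subseteq>
        lam ` {l. l \<le> m \<and> even (m - l)} - {lam m}"
    proof -
      \<comment> \<open>The other coincidence, l + m = -1, would make m - l odd.\<close>
      have "lam l \<noteq> lam m" if "l \<le> m - 2" "even (m - 2 - l)" for l
      proof
        assume "lam l = lam m"
        then have "l + m = - 1" using that by (auto simp: lam_eq_iff)
        then show False using that(2) by presburger
      qed
      then show ?thesis by auto
    qed
    have "lam m \<in> lam ` {l. l \<le> m \<and> even (m - l)}"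
      by simp
    then show ?thesis
      using sub in_span by (rule eig_span_if_triangular[OF linear_B])
  qed
qed

text \<open>\<open>Phi\<close> is the identity plus terms of higher weight, so x differs from
  \<open>Phi (Suc N) x\<close> by vectors covered by downward induction on the weight.\<close>

lemma wt_in_eig_span:
  assumes bound: "\<And>m x. x \<in> wt s K m \<Longrightarrow> \<bar>m\<bar> > int N \<Longrightarrow> x = 0"
    and "x \<in> wt s K m"
  shows "x \<in> span (\<Union>c\<in>range lam. eig s B c)"
  using assms(2)
proof (induction "nat (int N + 1 - m)" arbitrary: m x rule: less_induct)
  case less
  show ?case
  proof (cases "m > int N")
    case True
    then have "x = 0" using bound less.prems by auto
    then show ?thesis by (simp add: span_zero)
  next
    case False
    have "Phi (Suc N) x = x + (\<Sum>n\<in>{1..Suc N}. s (phi_coeff n) ((E ^^ n) x))"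
      proof -
      have "{..Suc N} = insert 0 {1..Suc N}" by auto
      then show ?thesis unfolding Phi_def by (simp del: funpow.simps(2) phi_coeff.simps(2) sum.cl_ivl_Suc)
    qed
    then have eq: "x = Phi (Suc N) x - (\<Sum>n\<in>{1..Suc N}. s (phi_coeff n) ((E ^^ n) x))"
      by (simp only: add_diff_cancel_right')
    have "Phi (Suc N) x \<in> span (\<Union>c\<in>range lam. eig s B c)"
      by (rule subsetD[OF span_mono Phi_in_eig_span[OF bound less.prems]]) auto
    moreover have "(E ^^ n) x \<in> span (\<Union>c\<in>range lam. eig s B c)" if "n \<in> {1..Suc N}" for n
      using that False by (intro less.hyps[OF _ wt_E_pow[OF less.prems]]) auto
    then have "(\<Sum>n\<in>{1..Suc N}. s (phi_coeff n) ((E ^^ n) x)) \<in> span (\<Union>c\<in>range lam. eig s B c)"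
      by (intro span_sum span_scale) auto
    ultimately have "Phi (Suc N) x - (\<Sum>n\<in>{1..Suc N}. s (phi_coeff n) ((E ^^ n) x)) \<in> span (\<Union>c\<in>range lam. eig s B c)"
      by (rule span_diff)
    then show ?thesis unfolding eq[symmetric] .
  qed
qed

lemma range_lam: "range lam = range (\<lambda>n. lam (int n))"
proof -
  have "lam j \<in> range (\<lambda>n. lam (int n))" for j
  proof (cases "j \<ge> 0")
    case True
    then have "lam j = lam (int (nat j))" by simp
    then show ?thesis by blast
  next
    case False
    then have "lam j = lam (int (nat (- 1 - j)))" by (simp add: lam_reflect)
    then show ?thesis by blast
  qed
  then show ?thesis by auto
qed

lemma eig_B_span:
  assumes "finite A" "span A = UNIV" and "diagonalizable_with s (range (\<lambda>n :: int. vv powi n)) K"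
  shows "span (\<Union>c\<in>range (\<lambda>n. lam (int n)). eig s B c) = UNIV"
proof -
  obtain C where C: "is_basis s C" "\<forall>w\<in>C. \<exists>c\<in>range (\<lambda>n :: int. vv powi n). K w = s c w"
    using assms(3) unfolding diagonalizable_with_def by blast
  have "finite C"
    using finite_basis vector_space_axioms assms(1,2) C(1) by blast
  obtain h where h: "\<And>w. w \<in> C \<Longrightarrow> K w = s (vv powi (h w)) w"
    using bchoice[of C "\<lambda>w n. K w = s (vv powi n) w"] C(2) by auto
  obtain N where N: "\<And>w. w \<in> C \<Longrightarrow> nat \<bar>h w\<bar> \<le> N"
    using finite_nat_set_iff_bounded_le[of "(\<lambda>w. nat \<bar>h w\<bar>) ` C"] \<open>finite C\<close> by auto
  \<comment> \<open>N bounds the weights of the finite eigenbasis C, so weight vectors beyond N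
    vanish.\<close>
  have bound: "x = 0" if "x \<in> wt s K m" "\<bar>m\<bar> > int N" for m x
  proof (rule eigenvalue_of_basis[OF linear(3) C(1) h])
    show "K x = s (vv powi m) x" using that by (simp add: wt_def eig_def)
    show "vv powi m \<notin> (\<lambda>w. vv powi h w) ` C" using that N by fastforce
  qed auto
  have "C \<subseteq> span (\<Union>c\<in>range lam. eig s B c)"
  proof
    fix w assume "w \<in> C"
    then have "w \<in> wt s K (h w)" using h by (simp add: wt_def eig_def)
    with bound show "w \<in> span (\<Union>c\<in>range lam. eig s B c)" by (rule wt_in_eig_span)
  qed
  then have "span C \<subseteq> span (\<Union>c\<in>range lam. eig s B c)"
    by (rule span_minimal) simp
  then show ?thesis using C(1) unfolding range_lam by (auto simp: is_basis_def)
qed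

end

section \<open>The quantum Serre relation of the coideal subalgebra\<close>

definition serre :: "(Cq \<Rightarrow> 'v::ab_group_add \<Rightarrow> 'v) \<Rightarrow> ('v \<Rightarrow> 'v) \<Rightarrow> ('v \<Rightarrow> 'v) \<Rightarrow> 'v \<Rightarrow> 'v" where
  "serre s A C x = A (A (C x)) - s (vv + inverse vv) (A (C (A x))) + C (A (A x))"

context vector_space begin

text \<open>
  The scalars \<open>v\<close>, \<open>v\<^sup>-\<^sup>1\<close>, \<open>v / (v - v\<^sup>-\<^sup>1)\<close>, \<open>1 / [2]\<close> enter as atoms \<open>v\<close>, \<open>p\<close>, \<open>g\<close>, \<open>c\<close>, so that
  the simplifier can bring both words and coefficients into normal form.
\<close>

lemma serre_expansion:
  fixes F1 F2 Y1 Y2 L1 L2 :: "'b \<Rightarrow> 'b" and v p g c :: 'a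
  assumes lin: "\<And>x y. F1 (x + y) = F1 x + F1 y" "\<And>x y. F2 (x + y) = F2 x + F2 y"
     "\<And>x y. Y1 (x + y) = Y1 x + Y1 y" "\<And>x y. Y2 (x + y) = Y2 x + Y2 y"
     "\<And>x y. L1 (x + y) = L1 x + L1 y" "\<And>x y. L2 (x + y) = L2 x + L2 y"
     "\<And>x y. F1 (x - y) = F1 x - F1 y" "\<And>x y. F2 (x - y) = F2 x - F2 y"
     "\<And>x y. Y1 (x - y) = Y1 x - Y1 y" "\<And>x y. Y2 (x - y) = Y2 x - Y2 y"
     "\<And>x y. L1 (x - y) = L1 x - L1 y" "\<And>x y. L2 (x - y) = L2 x - L2 y"
     "\<And>r x. F1 (scale r x) = scale r (F1 x)" "\<And>r x. F2 (scale r x) = scale r (F2 x)"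
     "\<And>r x. Y1 (scale r x) = scale r (Y1 x)" "\<And>r x. Y2 (scale r x) = scale r (Y2 x)"
     "\<And>r x. L1 (scale r x) = scale r (L1 x)" "\<And>r x. L2 (scale r x) = scale r (L2 x)"
   and comm: "\<And>x. L1 (F1 x) = scale (v * v) (F1 (L1 x))" "\<And>x. L1 (F2 x) = scale p (F2 (L1 x))"
     "\<And>x. F1 (L2 x) = scale v (L2 (F1 x))"
     "\<And>x. L1 (Y1 x) = scale (p * p) (Y1 (L1 x))" "\<And>x. L1 (Y2 x) = scale v (Y2 (L1 x))"
     "\<And>x. Y1 (L2 x) = scale p (L2 (Y1 x))" "\<And>x. L1 (L2 x) = L2 (L1 x)"
     "\<And>x. Y1 (F2 x) = scale p (F2 (Y1 x))" "\<And>x. F1 (Y2 x) = scale v (Y2 (F1 x))"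
     "\<And>x. Y1 (F1 x) = scale (v * v) (F1 (Y1 x)) + scale g (x - L1 (L1 x))"
   and serre: "\<And>x. F1 (F1 (F2 x)) = scale v (F1 (F2 (F1 x))) + scale p (F1 (F2 (F1 x))) - F2 (F1 (F1 x))"
     "\<And>x. Y1 (Y1 (Y2 x)) = scale v (Y1 (Y2 (Y1 x))) + scale p (Y1 (Y2 (Y1 x))) - Y2 (Y1 (Y1 x))"
   and v: "v * p = 1" and g: "p * (p * g) = g - 1" and c: "v * (c * c) = c * c + c * c - p * (c * c) - 1"
  defines "A \<equiv> \<lambda>x. F1 x + Y1 x + scale c (L1 x)"
  shows "A (A (F2 x)) - scale v (A (F2 (A x))) - scale p (A (F2 (A x))) + F2 (A (A x)) = F2 x"
    and "A (A (Y2 x)) - scale v (A (Y2 (A x))) - scale p (A (Y2 (A x))) + Y2 (A (A x)) = Y2 x"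
    and "A (A (L2 x)) - scale v (A (L2 (A x))) - scale p (A (L2 (A x))) + L2 (A (A x)) = L2 x"
proof -
  have v': "p * v = 1" "v * (p * r) = r" "p * (v * r) = r" for r
    using v by (simp_all add: mult_ac flip: mult.assoc[of v p r] mult.assoc[of p v r])
  have g': "p * (g * p) = g - 1" "g * (p * p) = g - 1"
    using g by (simp_all add: mult_ac)
  have g'': "v * g = v + p * g"
  proof -
    have "v * g = v * (1 + p * (p * g))" using g by simp
    then show ?thesis by (simp only: distrib_left v') simp
  qed
  have c': "c * (c * v) = c * c + c * c - c * (c * p) - 1" "c * (v * c) = c * c + c * c - c * (c * p) - 1"
    using c by (simp_all add: mult_ac)
  note [simp] = lin comm(1-8,10) scale_right_distrib scale_right_diff_distrib
  show "A (A (F2 x)) - scale v (A (F2 (A x))) - scale p (A (F2 (A x))) + F2 (A (A x)) = F2 x"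
    unfolding A_def
    by (simp add: v v')
      (simp add: serre v v' g g' g'' scale_left_distrib scale_left_diff_distrib algebra_simps)
  \<comment> \<open>Words are normalized with F letters to the left of Y letters, hence the reversed
    orientation of the hypothesis on F1 and Y2.\<close>
  have Y2_F1: "Y2 (F1 x) = scale p (F1 (Y2 x))" for x
    using comm(9)[of x] v' by simp
  show "A (A (Y2 x)) - scale v (A (Y2 (A x))) - scale p (A (Y2 (A x))) + Y2 (A (A x)) = Y2 x"
    unfolding A_def
    by (simp add: v v' Y2_F1)
      (simp add: serre v v' g g' g'' Y2_F1 scale_left_distrib scale_left_diff_distrib algebra_simps)
  show "A (A (L2 x)) - scale v (A (L2 (A x))) - scale p (A (L2 (A x))) + L2 (A (A x)) = L2 x"
    unfolding A_def
    by (simp add: v v',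
      simp add: serre v v' g g' g'' c c' scale_left_distrib scale_left_diff_distrib algebra_simps,
      simp only: mult_2_right distrib_left scale_left_distrib)
qed

end

text \<open>\<open>B i\<close> is the action of \<open>b\<^sub>i\<close> on the tensor product with \<open>\<N>\<close>, transported along \<open>v \<mapsto> v \<otimes> 1\<close>.\<close>

locale qg_module = vector_space s
  for s :: "Cq \<Rightarrow> 'v::ab_group_add \<Rightarrow> 'v" +
  fixes a :: "'i \<Rightarrow> 'i \<Rightarrow> int" and E F K K' :: "'i \<Rightarrow> 'v \<Rightarrow> 'v"
  assumes linear: "\<And>i. Vector_Spaces.linear s s (E i)" "\<And>i. Vector_Spaces.linear s s (F i)"
      "\<And>i. Vector_Spaces.linear s s (K i)" "\<And>i. Vector_Spaces.linear s s (K' i)"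
    and K'_K: "\<And>i x. K' i (K i x) = x" and K_K': "\<And>i x. K i (K' i x) = x"
    and K_K: "\<And>i j x. K i (K j x) = K j (K i x)"
    and K_E: "\<And>i j x. K i (E j x) = s (vv powi a i j) (E j (K i x))"
    and K_F: "\<And>i j x. K i (F j x) = s (vv powi (- a i j)) (F j (K i x))"
    and E_F: "\<And>i x. E i (F i x) = F i (E i x) + s (inverse (vv - inverse vv)) (K i x - K' i x)"
    and E_F_neq: "\<And>i j x. i \<noteq> j \<Longrightarrow> E i (F j x) = F j (E i x)"
    and E_E: "\<And>i j x. i \<noteq> j \<Longrightarrow> a i j = 0 \<Longrightarrow> E i (E j x) = E j (E i x)"
    and F_F: "\<And>i j x. i \<noteq> j \<Longrightarrow> a i j = 0 \<Longrightarrow> F i (F j x) = F j (F i x)"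
    and serre_E: "\<And>i j x. a i j = - 1 \<Longrightarrow> serre s (E i) (E j) x = 0"
    and serre_F: "\<And>i j x. a i j = - 1 \<Longrightarrow> serre s (F i) (F j) x = 0"
    and diag: "\<And>i. a i i = 2" and sym: "\<And>i j. a i j = a j i"
begin

lemmas lin = linear[THEN linear_simps(1)] linear[THEN linear_simps(2)] linear[THEN linear_simps(3)]
  linear[THEN linear_simps(4)] linear[THEN linear_simps(5)]

definition B :: "'i \<Rightarrow> 'v \<Rightarrow> 'v" where
  "B i x = F i x + s (inverse vv) (E i (K' i x)) + s (1 / qint qq 2) (K' i x)"

lemma eig_B_span:
  assumes "finite A" "span A = UNIV" and "diagonalizable_with s (range (\<lambda>n :: int. vv powi n)) (K i)"
  shows "span (\<Union>c\<in>range (\<lambda>n. lam (int n)). eig s (B i) c) = UNIV"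
proof -
  have KE: "K i (E i x) = s (vv powi 2) (E i (K i x))" and KF: "K i (F i x) = s (vv powi (- 2)) (F i (K i x))" for x
    using K_E[of i i x] K_F[of i i x] unfolding diag by simp_all
  have "sl2_module_axioms s (E i) (F i) (K i) (K' i)"
    by (intro sl2_module_axioms.intro linear K'_K KE KF E_F)
  then interpret sl2: sl2_module s "E i" "F i" "K i" "K' i"
    by (intro sl2_module.intro vector_space_axioms)
  have "sl2.B = B i" by (rule ext) (simp only: sl2.B_def B_def)
  then show ?thesis using sl2.eig_B_span[OF assms] by simp
qed

section \<open>Commutation rules for the inverse of K\<close>

lemma K'_E: "K' i (E j x) = s (vv powi (- a i j)) (E j (K' i x))"
proof -
  have "K' i (E j x) = K' i (E j (K i (K' i x)))" by (simp add: K_K')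
  also have "E j (K i (K' i x)) = s (vv powi (- a i j)) (K i (E j (K' i x)))"
    by (simp add: K_E flip: vv_powi_add)
  finally show ?thesis by (simp add: lin K'_K)
qed

lemma K'_F: "K' i (F j x) = s (vv powi a i j) (F j (K' i x))"
proof -
  have "K' i (F j x) = K' i (F j (K i (K' i x)))" by (simp add: K_K')
  also have "F j (K i (K' i x)) = s (vv powi a i j) (K i (F j (K' i x)))"
    by (simp add: K_F flip: vv_powi_add)
  finally show ?thesis by (simp add: lin K'_K)
qed

lemma K'_K': "K' i (K' j x) = K' j (K' i x)"
proof -
  have "K' i (K' j x) = K' i (K' j (K i (K j (K' j (K' i x)))))"
    by (simp add: K_K')
  also have "\<dots> = K' j (K' i x)"
    unfolding K_K[of i j] by (simp add: K'_K)
  finally show ?thesis .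
qed

lemma B_commute:
  assumes "i \<noteq> j" "a i j = 0"
  shows "B i (B j x) = B j (B i x)"
  using assms sym[of i j] E_E[of i j] F_F[of i j] E_F_neq[of i j] E_F_neq[of j i]
  by (simp add: B_def lin K'_E K'_F K'_K'[of i j] scale_right_distrib algebra_simps)

definition Y :: "'i \<Rightarrow> 'v \<Rightarrow> 'v" where
  "Y i x = s (inverse vv) (E i (K' i x))"

lemma B_eq: "B i x = F i x + Y i x + s (1 / qint qq 2) (K' i x)"
  by (simp add: B_def Y_def)

text \<open>The Serre expression is linear in its second operator, and
  \<open>serre_expansion\<close> shows that it reproduces each of the three summands of
  \<open>B j\<close>.\<close>

lemma serre_B:
  assumes "a i j = - 1"
  shows "serre s (B i) (B j) x = B j x"
proof -
  have ij: "i \<noteq> j" using assms diag[of i] by auto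
  have ji: "a j i = - 1" using assms sym by simp
  have vv_simps: "vv powi 2 = vv * vv" "vv powi (- 2) = inverse vv * inverse vv" "vv powi (- 1) = inverse vv"
    by (simp_all add: power2_eq_square power_int_minus)
  have cancel: "inverse vv * (vv * r) = r" "vv * (inverse vv * r) = r" for r
    by (simp_all flip: mult.assoc)
  note comm = K'_E K'_F assms ji diag vv_simps cancel
  define c where "c = 1 / qint qq 2"
  define g where "g = vv * inverse (vv - inverse vv)"
  have B: "B i x = F i x + Y i x + s c (K' i x)" for i x
    by (simp add: B_eq c_def)
  have g: "inverse vv * (inverse vv * g) = g - 1"
  proof -
    have "g * (vv - inverse vv) = vv" unfolding g_def using vv_ne_inverse(1) by simp
    then show ?thesis by (simp add: field_simps)
  qed
  \<comment> \<open>The value 1/[2] of b_i on N enters here, through [2]^2 = 2 - v - v^-1.\<close>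
  have c: "vv * (c * c) = c * c + c * c - inverse vv * (c * c) - 1"
  proof -
    have "qint qq 2 * qint qq 2 = 2 - vv - inverse vv"
      by (simp add: qint_qq_2(1) qq_vv field_simps)
    then have "c * c * (2 - vv - inverse vv) = 1"
      using qint_qq_2(2) by (simp add: c_def field_simps)
    then show ?thesis by (simp add: algebra_simps)
  qed
  \<comment> \<open>Moving every K' to the right yields the same scalar v^-3 in all three words, so
    the Serre relation passes from E to Y.\<close>
  have YE: "Y i (Y i (Y j x)) = s (inverse vv * inverse vv * inverse vv) (E i (E i (E j (K' i (K' i (K' j x))))))"
    "Y i (Y j (Y i x)) = s (inverse vv * inverse vv * inverse vv) (E i (E j (E i (K' i (K' i (K' j x))))))"
    "Y j (Y i (Y i x)) = s (inverse vv * inverse vv * inverse vv) (E j (E i (E i (K' i (K' i (K' j x))))))" for x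
    by (simp_all add: Y_def lin comm K'_K'[of j i] mult.assoc)
  have serreY: "Y i (Y i (Y j x)) = s vv (Y i (Y j (Y i x))) + s (inverse vv) (Y i (Y j (Y i x))) - Y j (Y i (Y i x))" for x
  proof -
    have "s (inverse vv * inverse vv * inverse vv) (serre s (E i) (E j) (K' i (K' i (K' j x)))) = 0"
      by (simp add: serre_E assms)
    then show ?thesis
      unfolding YE serre_def by (simp add: scale_right_distrib scale_left_distrib scale_right_diff_distrib algebra_simps)
  qed
  have serreF: "F i (F i (F j x)) = s vv (F i (F j (F i x))) + s (inverse vv) (F i (F j (F i x))) - F j (F i (F i x))" for x
    using serre_F[OF assms, of x] by (simp add: serre_def scale_left_distrib algebra_simps)
  have linY: "Y i (x + y) = Y i x + Y i y" "Y i (x - y) = Y i x - Y i y" "Y i (s r x) = s r (Y i x)" for i x y r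
    by (simp_all add: Y_def lin scale_right_distrib scale_right_diff_distrib mult.commute)
  have commY:
    "K' i (Y i x) = s (inverse vv * inverse vv) (Y i (K' i x))" "K' i (Y j x) = s vv (Y j (K' i x))"
    "Y i (K' j x) = s (inverse vv) (K' j (Y i x))"
    "Y i (F j x) = s (inverse vv) (F j (Y i x))" "F i (Y j x) = s vv (Y j (F i x))"
    "Y i (F i x) = s (vv * vv) (F i (Y i x)) + s g (x - K' i (K' i x))" for x
    using ij by (simp_all add: Y_def lin comm K'_K'[of j i] E_F E_F_neq K_K' g_def scale_right_distrib
        scale_right_diff_distrib power2_eq_square mult_ac)
  have commF: "F i (K' j x) = s vv (K' j (F i x))" for x
    by (simp add: comm)
  have commK: "K' i (F i x) = s (vv * vv) (F i (K' i x))" "K' i (F j x) = s (inverse vv) (F j (K' i x))" for x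
    by (simp_all add: comm power2_eq_square)
  note aux = serre_expansion[of "F i" "F j" "Y i" "Y j" "K' i" "K' j" vv "inverse vv" g c, folded B[of i],
      OF lin(2,2) linY(1,1) lin(4,4) lin(6,6) linY(2,2) lin(8,8) lin(14,14) linY(3,3) lin(16,16)
       commK commF commY(1,2,3) K'_K' commY(4,5,6) serreF serreY _ g c]
  have linB: "B i (x + y) = B i x + B i y" "B i (s r x) = s r (B i x)" for x y r
    by (simp_all add: B lin linY scale_right_distrib mult.commute)
  have "serre s (B i) (F j) x = F j x" "serre s (B i) (Y j) x = Y j x" "serre s (B i) (K' j) x = K' j x"
    using aux[of x] by (simp_all add: serre_def scale_left_distrib diff_diff_eq)
  moreover have "serre s (B i) (B j) x =
      serre s (B i) (F j) x + serre s (B i) (Y j) x + s c (serre s (B i) (K' j) x)"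
    unfolding serre_def B[of j]
    by (simp add: linB scale_right_distrib scale_right_diff_distrib mult.commute[of c])
  ultimately show ?thesis by (simp only: B)
qed

end

section \<open>The braid relation\<close>

lemma lam_step: "inverse qq * lam (j + 1) + qq * lam j = vv powi (- 1 - j)"
  "inverse qq * lam (j - 1) + qq * lam j = vv powi j"
proof -
  define J where "J = vv powi j"
  have nz: "J \<noteq> 0" "inverse vv - vv \<noteq> 0" using vv_ne_inverse by (simp_all add: J_def)
  have e: "vv powi (j + 1) = J * vv" "vv powi (- (j + 1)) = 1 / (J * vv)"
    "vv powi (j - 1) = J / vv" "vv powi (- (j - 1)) = vv / J" "vv powi (- j) = 1 / J"
    "vv powi (- 1 - j) = 1 / (J * vv)"
    by (simp_all add: J_def power_int_add power_int_diff power_int_minus field_simps)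
  have "inverse qq * (qq * (J * vv) - inverse qq * (1 / (J * vv))) + qq * (qq * J - inverse qq * (1 / J)) =
    1 / (J * vv) * (inverse vv - vv)"
    using nz by (simp add: field_simps qq_vv)
  then have "inverse qq * ((qq * (J * vv) - inverse qq * (1 / (J * vv))) / (inverse vv - vv)) +
      qq * ((qq * J - inverse qq * (1 / J)) / (inverse vv - vv)) = 1 / (J * vv)"
    using nz(2) by (simp only: times_divide_eq_right flip: add_divide_distrib) simp
  then show "inverse qq * lam (j + 1) + qq * lam j = vv powi (- 1 - j)"
    unfolding lam_def e J_def[symmetric] .
  have "inverse qq * (qq * (J / vv) - inverse qq * (vv / J)) + qq * (qq * J - inverse qq * (1 / J)) =
    J * (inverse vv - vv)"
    using nz by (simp add: field_simps qq_vv)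
  then have "inverse qq * ((qq * (J / vv) - inverse qq * (vv / J)) / (inverse vv - vv)) +
      qq * ((qq * J - inverse qq * (1 / J)) / (inverse vv - vv)) = J"
    using nz(2) by (simp only: times_divide_eq_right flip: add_divide_distrib) simp
  then show "inverse qq * lam (j - 1) + qq * lam j = vv powi j"
    unfolding lam_def e J_def[symmetric] .
qed

lemma tau_step:
  "tau (j + 1) = (inverse qq * lam (j + 1) + qq * lam j) * tau j"
  "tau (j - 1) = (inverse qq * lam (j - 1) + qq * lam j) * tau j"
  unfolding lam_step using tau_Suc[of j] tau_Suc[of "j - 1"]
  by (simp_all flip: mult.assoc vv_powi_add)

text \<open>By Vieta, lam (j + 1) and lam (j - 1) are the roots of the quadratic that the Serre
  relation produces on the eigenspace for lam j.\<close>

lemma lam_neighbours: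
  "lam (j + 1) + lam (j - 1) = (vv + inverse vv) * lam j"
  "lam (j + 1) * lam (j - 1) = lam j * lam j - 1"
proof -
  define J where "J = vv powi j"
  define d where "d = inverse vv - vv"
  have nz: "J \<noteq> 0" "d \<noteq> 0" using vv_ne_inverse by (simp_all add: J_def d_def)
  have e: "vv powi (j + 1) = J * vv" "vv powi (- (j + 1)) = 1 / (J * vv)"
    "vv powi (j - 1) = J / vv" "vv powi (- (j - 1)) = vv / J" "vv powi (- j) = 1 / J"
    by (simp_all add: J_def power_int_add power_int_diff power_int_minus field_simps)
  have "(qq * (J * vv) - inverse qq * (1 / (J * vv))) + (qq * (J / vv) - inverse qq * (vv / J)) =
    (vv + inverse vv) * (qq * J - inverse qq * (1 / J))"
    using nz(1) by (simp add: field_simps)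
  then show "lam (j + 1) + lam (j - 1) = (vv + inverse vv) * lam j"
    unfolding lam_def e d_def[symmetric] J_def[symmetric]
    by (simp only: times_divide_eq_right flip: add_divide_distrib)
  have *: "(qq * (J * vv) - inverse qq * (1 / (J * vv))) * (qq * (J / vv) - inverse qq * (vv / J)) =
    (qq * J - inverse qq * (1 / J)) * (qq * J - inverse qq * (1 / J)) - d * d"
    using nz(1) unfolding d_def by (simp add: field_simps qq_vv)
  have "(qq * (J * vv) - inverse qq * (1 / (J * vv))) / d * ((qq * (J / vv) - inverse qq * (vv / J)) / d) =
    (qq * J - inverse qq * (1 / J)) / d * ((qq * J - inverse qq * (1 / J)) / d) - 1"
    unfolding times_divide_times_eq * using nz(2) by (simp add: diff_divide_distrib)
  then show "lam (j + 1) * lam (j - 1) = lam j * lam j - 1"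
    unfolding lam_def e d_def[symmetric] J_def[symmetric] .
qed

text \<open>With l and m the two neighbouring values, C x is killed by (A - l) (A - m). As l and m
  differ, it splits by the two spectral projections.\<close>

lemma eig_neighbours:
  assumes "Vector_Spaces.linear s s A" "Vector_Spaces.linear s s C"
    and "serre s A C x = C x" and x: "x \<in> eig s A (lam j)"
  obtains y z where "C x = y + z" "y \<in> eig s A (lam (j + 1))" "z \<in> eig s A (lam (j - 1))"
proof -
  interpret A: Vector_Spaces.linear s s A by fact
  note lin = linear_simps[OF assms(1)] linear_simps[OF assms(2)]
  define y where "y = C x"
  define l where "l = lam (j + 1)"
  define m where "m = lam (j - 1)"
  define d where "d = 1 / (l - m)"
  \<comment> \<open>Equality would require 2 j = -1.\<close>
  have "l \<noteq> m" unfolding l_def m_def lam_eq_iff by presburger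
  then have d: "d * (l - m) = 1" by (simp add: d_def)
  have "A (A y) - s (vv + inverse vv) (s (lam j) (A y)) + s (lam j) (s (lam j) y) = y"
    using assms(3) x by (simp add: serre_def eig_def lin y_def)
  then have "A (A y) = s ((vv + inverse vv) * lam j) (A y) - s (lam j * lam j - 1) y"
    by (simp add: A.vs1.scale_left_diff_distrib algebra_simps)
  then have AA: "A (A y) = s l (A y) + s m (A y) - s (l * m) y"
    unfolding lam_neighbours[symmetric] l_def m_def by (simp add: A.vs1.scale_left_distrib)
  show thesis
  proof (rule that)
    have "y = s (d * (l - m)) y" by (simp add: d)
    then have "y = s (d * l) y - s (d * m) y"
      by (simp only: right_diff_distrib A.vs1.scale_left_diff_distrib)
    then show "C x = s d (A y - s m y) + s d (s l y - A y)"
      by (simp add: A.vs1.scale_right_diff_distrib flip: y_def)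
    show "s d (A y - s m y) \<in> eig s A (lam (j + 1))" "s d (s l y - A y) \<in> eig s A (lam (j - 1))"
      unfolding eig_def l_def[symmetric] m_def[symmetric]
      by (simp_all add: lin AA A.vs1.scale_right_diff_distrib A.vs1.scale_right_distrib mult_ac)
  qed
qed

text \<open>Negative indices reduce to nonnegative ones by reflection. They are needed because -1 is
  a neighbour of 0.\<close>

lemma tau_eigenvector:
  assumes "\<And>n x. x \<in> eig s B (lam (int n)) \<Longrightarrow> T x = s (tau (int n)) x"
    and "x \<in> eig s B (lam j)"
  shows "T x = s (tau j) x"
proof (cases "j \<ge> 0")
  case True
  then show ?thesis using assms(1)[of x "nat j"] assms(2) by simp
next
  case False
  then have "int (nat (- 1 - j)) = - 1 - j" by simp
  then show ?thesis
    using assms(1)[of x "nat (- 1 - j)"] assms(2) by (simp add: lam_reflect tau_reflect)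
qed

lemma braid_relation:
  assumes B1: "Vector_Spaces.linear s s B1" and B2: "Vector_Spaces.linear s s B2"
    and T1: "Vector_Spaces.linear s s T1" and T2: "Vector_Spaces.linear s s T2"
    and span1: "module.span s (\<Union>c\<in>range (\<lambda>n. lam (int n)). eig s B1 c) = UNIV"
    and span2: "module.span s (\<Union>c\<in>range (\<lambda>n. lam (int n)). eig s B2 c) = UNIV"
    and tau1: "\<And>n x. x \<in> eig s B1 (lam (int n)) \<Longrightarrow> T1 x = s (tau (int n)) x"
    and tau2: "\<And>n x. x \<in> eig s B2 (lam (int n)) \<Longrightarrow> T2 x = s (tau (int n)) x"
    and serre1: "\<And>x. serre s B1 B2 x = B2 x" and serre2: "\<And>x. serre s B2 B1 x = B1 x"
  shows "T1 \<circ> T2 \<circ> T1 = T2 \<circ> T1 \<circ> T2"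
proof -
  interpret V: Vector_Spaces.linear s s B1 by fact
  note lin = linear_simps[OF B1] linear_simps[OF B2] linear_simps[OF T1] linear_simps[OF T2]
  have T1_eig: "T1 x = s (tau j) x" if "x \<in> eig s B1 (lam j)" for x j
    using tau_eigenvector[OF _ that] tau1 by blast
  have T2_eig: "T2 x = s (tau j) x" if "x \<in> eig s B2 (lam j)" for x j
    using tau_eigenvector[OF _ that] tau2 by blast
  note scale = V.vs1.scale_right_distrib V.vs1.scale_left_distrib
  define Z where "Z x = s (inverse qq) (B1 (B2 x)) + s qq (B2 (B1 x))" for x
  have linZ: "Vector_Spaces.linear s s Z"
    unfolding Vector_Spaces.linear_iff using V.vs1.vector_space_axioms
    by (auto simp: Z_def lin scale algebra_simps)
  have comp: "Vector_Spaces.linear s s (g \<circ> h)"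
    if "Vector_Spaces.linear s s g" "Vector_Spaces.linear s s h" for g h
    using that by (auto simp: Vector_Spaces.linear_iff)
  have T1_B2: "T1 \<circ> B2 = Z \<circ> T1"
  proof (rule linear_eq_if_eq_on_spanning[OF comp comp span1])
    fix x assume "x \<in> (\<Union>c\<in>range (\<lambda>n. lam (int n)). eig s B1 c)"
    then obtain j where x: "x \<in> eig s B1 (lam j)" by auto
    obtain y z where yz: "B2 x = y + z" and y: "y \<in> eig s B1 (lam (j + 1))" and z: "z \<in> eig s B1 (lam (j - 1))"
      using eig_neighbours[OF B1 B2 serre1 x] by blast
    have "T1 (B2 x) = s (tau (j + 1)) y + s (tau (j - 1)) z"
      by (simp add: yz lin T1_eig[OF y] T1_eig[OF z])
    also have "\<dots> = s (inverse qq * lam (j + 1) * tau j) y + s (qq * lam j * tau j) y +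
        (s (inverse qq * lam (j - 1) * tau j) z + s (qq * lam j * tau j) z)"
      unfolding tau_step by (simp only: scale distrib_right)
    also have "\<dots> = Z (T1 x)"
      using x y z by (simp add: Z_def T1_eig[OF x] lin yz eig_def scale mult_ac add_ac)
    finally show "(T1 \<circ> B2) x = (Z \<circ> T1) x" by simp
  qed (fact B2 T1 linZ)+
  have B1_T2: "B1 \<circ> T2 = T2 \<circ> Z"
  proof (rule linear_eq_if_eq_on_spanning[OF comp comp span2])
    fix x assume "x \<in> (\<Union>c\<in>range (\<lambda>n. lam (int n)). eig s B2 c)"
    then obtain j where x: "x \<in> eig s B2 (lam j)" by auto
    obtain y z where yz: "B1 x = y + z" and y: "y \<in> eig s B2 (lam (j + 1))" and z: "z \<in> eig s B2 (lam (j - 1))"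
      using eig_neighbours[OF B2 B1 serre2 x] by blast
    \<comment> \<open>\<open>tau_step\<close> read from the neighbouring index back to j.\<close>
    have tau: "tau j = (inverse qq * lam j + qq * lam (j + 1)) * tau (j + 1)"
      "tau j = (inverse qq * lam j + qq * lam (j - 1)) * tau (j - 1)"
      using tau_step(2)[of "j + 1"] tau_step(1)[of "j - 1"] by simp_all
    have "B1 (T2 x) = s (tau j) y + s (tau j) z"
      by (simp add: T2_eig[OF x] lin yz scale)
    also have "s (tau j) y = s (inverse qq * lam j * tau (j + 1)) y + s (qq * lam (j + 1) * tau (j + 1)) y"
      unfolding tau(1) by (simp only: scale distrib_right)
    also have "s (tau j) z = s (inverse qq * lam j * tau (j - 1)) z + s (qq * lam (j - 1) * tau (j - 1)) z"
      unfolding tau(2) by (simp only: scale distrib_right)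
    also have "s (inverse qq * lam j * tau (j + 1)) y + s (qq * lam (j + 1) * tau (j + 1)) y +
        (s (inverse qq * lam j * tau (j - 1)) z + s (qq * lam (j - 1) * tau (j - 1)) z) = T2 (Z x)"
    proof -
      have "B2 y = s (lam (j + 1)) y" "B2 z = s (lam (j - 1)) z" "B2 x = s (lam j) x"
        using x y z by (auto simp: eig_def)
      then show ?thesis
        by (simp add: Z_def lin yz scale T2_eig[OF y] T2_eig[OF z] mult_ac add_ac)
    qed
    finally show "(B1 \<circ> T2) x = (T2 \<circ> Z) x" by simp
  qed (fact B1 T2 linZ)+
  show ?thesis
  proof (rule linear_eq_if_eq_on_spanning[OF comp[OF comp[OF T1 T2] T1] comp[OF comp[OF T2 T1] T2] span2])
    fix x assume "x \<in> (\<Union>c\<in>range (\<lambda>n. lam (int n)). eig s B2 c)"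
    then obtain n where x: "x \<in> eig s B2 (lam (int n))" by auto
    \<comment> \<open>Passing B1 through T2 gives Z, and passing Z through T1 gives B2. So T2 T1 x
      is an eigenvector of B1, and both sides of the braid relation equal tau n times it.\<close>
    have "B1 (T2 (T1 x)) = T2 (T1 (B2 x))"
      using B1_T2[THEN fun_cong, of "T1 x"] T1_B2[THEN fun_cong, of x] by simp
    also have "\<dots> = s (lam (int n)) (T2 (T1 x))"
      using x by (simp add: eig_def lin)
    finally have "T2 (T1 x) \<in> eig s B1 (lam (int n))" by (simp add: eig_def)
    then show "(T1 \<circ> T2 \<circ> T1) x = (T2 \<circ> T1 \<circ> T2) x"
      by (simp add: tau1 tau2[OF x] lin)
  qed
qed

text \<open>B1 preserves the eigenspaces of B2, hence commutes with T2; then T2 preserves the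
  eigenspaces of B1, hence commutes with T1.\<close>

lemma commuting_relation:
  assumes B1: "Vector_Spaces.linear s s B1"
    and T1: "Vector_Spaces.linear s s T1" and T2: "Vector_Spaces.linear s s T2"
    and span1: "module.span s (\<Union>c\<in>range (\<lambda>n. lam (int n)). eig s B1 c) = UNIV"
    and span2: "module.span s (\<Union>c\<in>range (\<lambda>n. lam (int n)). eig s B2 c) = UNIV"
    and tau1: "\<And>n x. x \<in> eig s B1 (lam (int n)) \<Longrightarrow> T1 x = s (tau (int n)) x"
    and tau2: "\<And>n x. x \<in> eig s B2 (lam (int n)) \<Longrightarrow> T2 x = s (tau (int n)) x"
    and B_commute: "\<And>x. B1 (B2 x) = B2 (B1 x)"
  shows "T1 \<circ> T2 = T2 \<circ> T1"
proof -
  note lin = linear_simps[OF B1] linear_simps[OF T1] linear_simps[OF T2]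
  have comp: "Vector_Spaces.linear s s (g \<circ> h)"
    if "Vector_Spaces.linear s s g" "Vector_Spaces.linear s s h" for g h
    using that by (auto simp: Vector_Spaces.linear_iff)
  have B1_T2: "B1 \<circ> T2 = T2 \<circ> B1"
  proof (rule linear_eq_if_eq_on_spanning[OF comp comp span2])
    fix x assume "x \<in> (\<Union>c\<in>range (\<lambda>n. lam (int n)). eig s B2 c)"
    then obtain n where x: "x \<in> eig s B2 (lam (int n))" by auto
    then have "B1 x \<in> eig s B2 (lam (int n))"
      by (simp add: eig_def lin flip: B_commute)
    then show "(B1 \<circ> T2) x = (T2 \<circ> B1) x"
      using tau2[OF x] by (simp add: tau2 lin)
  qed (fact B1 T2)+
  show ?thesis
  proof (rule linear_eq_if_eq_on_spanning[OF comp comp span1])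
    fix x assume "x \<in> (\<Union>c\<in>range (\<lambda>n. lam (int n)). eig s B1 c)"
    then obtain n where x: "x \<in> eig s B1 (lam (int n))" by auto
    then have "T2 x \<in> eig s B1 (lam (int n))"
      using B1_T2[THEN fun_cong, of x] by (simp add: eig_def lin)
    then show "(T1 \<circ> T2) x = (T2 \<circ> T1) x"
      using tau1[OF x] by (simp add: tau1 lin)
  qed (fact T1 T2)+
qed

section \<open>The quantum group and its modules\<close>

lemma ring_of_type_algebra_ring: "ring (ring_of_type_algebra :: 'r::ring_1 ring)"
proof -
  have "\<exists>y. x + y = 0" for x :: 'r
    using add.right_inverse by blast
  then show ?thesis
    unfolding ring_of_type_algebra_def using add.right_inverse
    by unfold_locales (auto simp: algebra_simps Units_def)
qed

lemma ring_of_type_algebra_simps [simp]: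
  "carrier ring_of_type_algebra = UNIV" "x \<otimes>\<^bsub>ring_of_type_algebra\<^esub> y = x * y"
  "x \<oplus>\<^bsub>ring_of_type_algebra\<^esub> y = x + y" "\<one>\<^bsub>ring_of_type_algebra\<^esub> = 1" "\<zero>\<^bsub>ring_of_type_algebra\<^esub> = 0"
  by (simp_all add: ring_of_type_algebra_def)

lemma ring_of_type_algebra_minus: "x \<ominus>\<^bsub>ring_of_type_algebra\<^esub> y = x - (y :: 'r::ring_1)"
proof -
  interpret ring "ring_of_type_algebra :: 'r ring" by (rule ring_of_type_algebra_ring)
  have "\<ominus>\<^bsub>ring_of_type_algebra\<^esub> y = - y"
    using r_neg[of y] by (simp add: eq_neg_iff_add_eq_0 add.commute)
  then show ?thesis by (simp add: a_minus_def)
qed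

lemma U_ideal: "ideal (U_ideal a) ring_of_type_algebra"
  unfolding U_ideal_def by (rule ring.genideal_ideal[OF ring_of_type_algebra_ring]) simp

lemma U2_ideal: "ideal (U2_ideal a) ring_of_type_algebra"
  unfolding U2_ideal_def by (rule ring.genideal_ideal[OF ring_of_type_algebra_ring]) simp

lemma U_ring: "ring (U a)"
  unfolding U_def by (rule ideal.quotient_is_ring[OF U_ideal])

lemma cls_ring_hom: "cls a \<in> ring_hom ring_of_type_algebra (U a)"
  unfolding U_def cls_def[abs_def] by (rule ideal.rcos_ring_hom[OF U_ideal])

lemma cls_closed [simp]: "cls a x \<in> carrier (U a)"
  using ring_hom_closed[OF cls_ring_hom, of x a] by simp

lemma cls_add: "cls a (x + y) = cls a x \<oplus>\<^bsub>U a\<^esub> cls a y"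
  and cls_mult: "cls a (x * y) = cls a x \<otimes>\<^bsub>U a\<^esub> cls a y"
  and cls_1: "cls a 1 = \<one>\<^bsub>U a\<^esub>"
  using ring_hom_add[OF cls_ring_hom, of x y a] ring_hom_mult[OF cls_ring_hom, of x y a]
    ring_hom_one[OF cls_ring_hom, of a] by simp_all

lemma cls_relator:
  assumes "r \<in> relators a"
  shows "cls a r = \<zero>\<^bsub>U a\<^esub>"
proof -
  interpret ideal "U_ideal a" "ring_of_type_algebra" by (rule U_ideal)
  have "r \<in> U_ideal a"
    using genideal_self[of "relators a"] assms by (auto simp: U_ideal_def)
  then have "cls a r = U_ideal a"
    unfolding cls_def by (rule a_rcos_const)
  then show ?thesis by (simp add: U_def FactRing_def)
qed

section \<open>The carrier of the coideal subalgebra\<close>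

definition U_iota_set :: "('i \<Rightarrow> 'i \<Rightarrow> int) \<Rightarrow> 'i gen free_alg set set" where
  "U_iota_set a = generate_ring (U a) (range (\<lambda>c. cls a (scal c)) \<union> range (Defs.b a))"

lemma U_iota_simps [simp]:
  "carrier (U_iota a) = U_iota_set a" "x \<otimes>\<^bsub>U_iota a\<^esub> y = x \<otimes>\<^bsub>U a\<^esub> y"
  "x \<oplus>\<^bsub>U_iota a\<^esub> y = x \<oplus>\<^bsub>U a\<^esub> y" "\<one>\<^bsub>U_iota a\<^esub> = \<one>\<^bsub>U a\<^esub>" "\<zero>\<^bsub>U_iota a\<^esub> = \<zero>\<^bsub>U a\<^esub>"
  by (simp_all add: U_iota_def U_iota_set_def)

lemma U_iota_set_subset: "U_iota_set a \<subseteq> carrier (U a)"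
  unfolding U_iota_set_def
  by (rule ring.generate_ring_incl[OF U_ring]) (auto simp: Defs.b_def)

lemma U_iota_set_intros:
  "Defs.b a i \<in> U_iota_set a" "cls a (scal c) \<in> U_iota_set a" "\<one>\<^bsub>U a\<^esub> \<in> U_iota_set a" "\<zero>\<^bsub>U a\<^esub> \<in> U_iota_set a"
  "x \<in> U_iota_set a \<Longrightarrow> y \<in> U_iota_set a \<Longrightarrow> x \<otimes>\<^bsub>U a\<^esub> y \<in> U_iota_set a"
  "x \<in> U_iota_set a \<Longrightarrow> y \<in> U_iota_set a \<Longrightarrow> x \<oplus>\<^bsub>U a\<^esub> y \<in> U_iota_set a"
  "x \<in> U_iota_set a \<Longrightarrow> y \<in> U_iota_set a \<Longrightarrow> x \<ominus>\<^bsub>U a\<^esub> y \<in> U_iota_set a"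
  unfolding U_iota_set_def a_minus_def
  by (auto intro: generate_ring.intros ring.zero_in_generate[OF U_ring])

lemma xdp_in_U_iota: "xdp a i n \<in> U_iota_set a"
  by (induction a i n rule: xdp.induct) (auto simp: Let_def intro!: U_iota_set_intros)

lemma End_ring_simps [simp]:
  "g \<in> carrier (End_ring s) \<longleftrightarrow> Vector_Spaces.linear s s g" "g \<otimes>\<^bsub>End_ring s\<^esub> h = g \<circ> h"
  "g \<oplus>\<^bsub>End_ring s\<^esub> h = (\<lambda>v. g v + h v)" "\<one>\<^bsub>End_ring s\<^esub> = id" "\<zero>\<^bsub>End_ring s\<^esub> = (\<lambda>_. 0)"
  by (simp_all add: End_ring_def)

locale U_module =
  fixes a :: "'i \<Rightarrow> 'i \<Rightarrow> int" and s :: "Cq \<Rightarrow> 'v::ab_group_add \<Rightarrow> 'v" and \<rho> :: "'i gen free_alg set \<Rightarrow> 'v \<Rightarrow> 'v"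
  assumes is_module: "is_module a (U a) s \<rho>"
begin

lemma \<rho>: "\<rho> \<in> ring_hom (U a) (End_ring s)" and \<rho>_scal: "\<rho> (cls a (scal c)) = s c"
  and vs: "vector_space s"
  using is_module by (auto simp: is_module_def)

lemma \<rho>_linear: "Vector_Spaces.linear s s (\<rho> (cls a x))"
  using ring_hom_closed[OF \<rho>, of "cls a x"] by simp

lemma \<rho>_add: "\<rho> (cls a (x + y)) v = \<rho> (cls a x) v + \<rho> (cls a y) v"
  using ring_hom_add[OF \<rho>, of "cls a x" "cls a y"] by (simp add: cls_add)

lemma \<rho>_mult: "\<rho> (cls a (x * y)) v = \<rho> (cls a x) (\<rho> (cls a y) v)"
  using ring_hom_mult[OF \<rho>, of "cls a x" "cls a y"] by (simp add: cls_mult)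

lemma \<rho>_1: "\<rho> (cls a 1) v = v"
  using ring_hom_one[OF \<rho>] by (simp add: cls_1)

lemma \<rho>_diff: "\<rho> (cls a (x - y)) v = \<rho> (cls a x) v - \<rho> (cls a y) v"
  using \<rho>_add[of "x - y" y v] by simp

lemma \<rho>_relator: "r \<in> relators a \<Longrightarrow> \<rho> (cls a r) v = 0"
proof -
  assume "r \<in> relators a"
  interpret U: ring "U a" by (rule U_ring)
  \<comment> \<open>The class of r is zero, so doubling r does not change it, and additivity forces
    the action to vanish.\<close>
  have "cls a (r + r) = cls a r"
    using \<open>r \<in> relators a\<close> by (simp add: cls_add cls_relator)
  then show ?thesis using \<rho>_add[of r r v] by simp
qed

lemmas \<rho>_simps = \<rho>_add \<rho>_diff \<rho>_mult \<rho>_1 \<rho>_scal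

lemma qg_module:
  assumes "\<And>i. a i i = 2" "\<And>i j. a i j = a j i"
  shows "qg_module s a (\<lambda>i. \<rho> (cls a (letter (Egen i)))) (\<lambda>i. \<rho> (cls a (letter (Fgen i))))
    (\<lambda>i. \<rho> (cls a (letter (Kgen i)))) (\<lambda>i. \<rho> (cls a (letter (Kinvgen i))))"
proof -
  interpret vector_space s by (rule vs)
  let ?E = "\<lambda>i. \<rho> (cls a (letter (Egen i)))"
  let ?F = "\<lambda>i. \<rho> (cls a (letter (Fgen i)))"
  let ?K = "\<lambda>i. \<rho> (cls a (letter (Kgen i)))"
  let ?L = "\<lambda>i. \<rho> (cls a (letter (Kinvgen i)))"
  have rel: "?L i (?K i x) - x = 0" "?K i (?L i x) - x = 0" "?K i (?K j x) - ?K j (?K i x) = 0"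
      "?K i (?E j x) - s (vv powi a i j) (?E j (?K i x)) = 0"
      "?K i (?F j x) - s (vv powi (- a i j)) (?F j (?K i x)) = 0"
      "?E i (?F i x) - ?F i (?E i x) - s (inverse (vv - inverse vv)) (?K i x - ?L i x) = 0" for i j x
  proof -
    have "letter (Kinvgen i) * letter (Kgen i) - 1 \<in> relators a"
      "letter (Kgen i) * letter (Kinvgen i) - 1 \<in> relators a"
      "letter (Kgen i) * letter (Kgen j) - letter (Kgen j) * letter (Kgen i) \<in> relators a"
      "letter (Kgen i) * letter (Egen j) - scal (vv powi a i j) * letter (Egen j) * letter (Kgen i) \<in> relators a"
      "letter (Kgen i) * letter (Fgen j) - scal (vv powi (- a i j)) * letter (Fgen j) * letter (Kgen i) \<in> relators a"
      "letter (Egen i) * letter (Fgen i) - letter (Fgen i) * letter (Egen i)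
        - scal (inverse (vv - inverse vv)) * (letter (Kgen i) - letter (Kinvgen i)) \<in> relators a"
      unfolding relators_def by blast+
    from this[THEN \<rho>_relator, of x] show "?L i (?K i x) - x = 0" "?K i (?L i x) - x = 0" "?K i (?K j x) - ?K j (?K i x) = 0"
      "?K i (?E j x) - s (vv powi a i j) (?E j (?K i x)) = 0"
      "?K i (?F j x) - s (vv powi (- a i j)) (?F j (?K i x)) = 0"
      "?E i (?F i x) - ?F i (?E i x) - s (inverse (vv - inverse vv)) (?K i x - ?L i x) = 0"
      by (simp_all only: \<rho>_simps)
  qed
  have rel_EF: "?E i (?F j x) - ?F j (?E i x) = 0" if "i \<noteq> j" for i j x
  proof -
    have "letter (Egen i) * letter (Fgen j) - letter (Fgen j) * letter (Egen i) \<in> relators a"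
      unfolding relators_def using that by blast
    from \<rho>_relator[OF this, of x] show ?thesis by (simp only: \<rho>_simps)
  qed
  have rel_comm: "?E i (?E j x) - ?E j (?E i x) = 0" "?F i (?F j x) - ?F j (?F i x) = 0"
    if "i \<noteq> j" "a i j = 0" for i j x
  proof -
    have "letter (Egen i) * letter (Egen j) - letter (Egen j) * letter (Egen i) \<in> relators a"
      "letter (Fgen i) * letter (Fgen j) - letter (Fgen j) * letter (Fgen i) \<in> relators a"
      unfolding relators_def using that by blast+
    from this[THEN \<rho>_relator, of x] show "?E i (?E j x) - ?E j (?E i x) = 0" "?F i (?F j x) - ?F j (?F i x) = 0"
      by (simp_all only: \<rho>_simps)
  qed
  have "qint vv 2 = vv + inverse vv"
    using vv_ne_inverse(1) by (simp add: qint_def power_int_minus field_simps power2_eq_square)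
  then have rel_serre: "serre s (?E i) (?E j) x = 0" "serre s (?F i) (?F j) x = 0" if "a i j = - 1" for i j x
  proof -
    have "letter (Egen i) * letter (Egen i) * letter (Egen j)
        - scal (qint vv 2) * letter (Egen i) * letter (Egen j) * letter (Egen i)
        + letter (Egen j) * letter (Egen i) * letter (Egen i) \<in> relators a"
      "letter (Fgen i) * letter (Fgen i) * letter (Fgen j)
        - scal (qint vv 2) * letter (Fgen i) * letter (Fgen j) * letter (Fgen i)
        + letter (Fgen j) * letter (Fgen i) * letter (Fgen i) \<in> relators a"
      unfolding relators_def using that by blast+
    from this[THEN \<rho>_relator, of x] \<open>qint vv 2 = vv + inverse vv\<close>
    show "serre s (?E i) (?E j) x = 0" "serre s (?F i) (?F j) x = 0"
      by (simp_all only: \<rho>_simps serre_def)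
  qed
  show ?thesis
  proof (intro qg_module.intro vector_space_axioms qg_module_axioms.intro \<rho>_linear)
    show "?E i (?F i x) = ?F i (?E i x) + s (inverse (vv - inverse vv)) (?K i x - ?L i x)" for i x
      using rel(6)[of i x] by (simp add: algebra_simps)
    show "a i i = 2" "a i j = a j i" for i j
      using assms by auto
  qed (fact rel(1-5)[unfolded right_minus_eq] rel_EF[unfolded right_minus_eq] rel_comm[unfolded right_minus_eq] rel_serre
      | assumption)+
qed

end

section \<open>The coproduct of the generators of the coideal subalgebra\<close>

text \<open>Supports can shrink under addition by cancellation; a common finite index set allows
  termwise comparison.\<close>

lemma tens_superset:
  assumes "finite A" "Poly_Mapping.keys x \<subseteq> A" "finite C" "Poly_Mapping.keys y \<subseteq> C"
  shows "tens x y = (\<Sum>u\<in>A. \<Sum>w\<in>C. Poly_Mapping.single (u, w) (Poly_Mapping.lookup x u * Poly_Mapping.lookup y w))"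
proof -
  have "tens x y = (\<Sum>u\<in>Poly_Mapping.keys x. \<Sum>w\<in>C. Poly_Mapping.single (u, w) (Poly_Mapping.lookup x u * Poly_Mapping.lookup y w))"
    unfolding tens_def using assms by (intro sum.cong refl sum.mono_neutral_left) (auto simp: in_keys_iff)
  also have "\<dots> = (\<Sum>u\<in>A. \<Sum>w\<in>C. Poly_Mapping.single (u, w) (Poly_Mapping.lookup x u * Poly_Mapping.lookup y w))"
    using assms by (intro sum.mono_neutral_left) (auto simp: in_keys_iff)
  finally show ?thesis .
qed

lemma tens_add: "tens (x + y) z = tens x z + tens y z" "tens z (x + y) = tens z x + tens z y"
proof -
  let ?A = "Poly_Mapping.keys x \<union> Poly_Mapping.keys y" and ?C = "Poly_Mapping.keys z"
  have sub: "Poly_Mapping.keys (x + y) \<subseteq> ?A" by (rule Poly_Mapping.keys_add)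
  show "tens (x + y) z = tens x z + tens y z"
    using sub by (simp add: tens_superset[of ?A _ ?C] lookup_add distrib_right single_add sum.distrib)
  show "tens z (x + y) = tens z x + tens z y"
    using sub by (simp add: tens_superset[of ?C _ ?A] lookup_add distrib_left single_add sum.distrib)
qed

lemma tens_single: "tens (Poly_Mapping.single u c) (Poly_Mapping.single w d) = Poly_Mapping.single (u, w) (c * d)"
  by (subst tens_superset[of "{u}" _ "{w}"]) auto

lemma coproduct_superset:
  assumes "finite A" "Poly_Mapping.keys x \<subseteq> A"
  shows "coproduct x = (\<Sum>w\<in>A. scal (Poly_Mapping.lookup x w) * coproduct_word w)"
  unfolding coproduct_def using assms
  by (intro sum.mono_neutral_left) (auto simp: in_keys_iff scal_def)

lemma coproduct_add: "coproduct (x + y) = coproduct x + coproduct y"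
proof -
  let ?A = "Poly_Mapping.keys x \<union> Poly_Mapping.keys y"
  have sub: "Poly_Mapping.keys (x + y) \<subseteq> ?A" by (rule Poly_Mapping.keys_add)
  show ?thesis
    using sub by (simp add: coproduct_superset[of ?A] lookup_add scal_def single_add distrib_right sum.distrib)
qed

lemma coproduct_single: "coproduct (Poly_Mapping.single w c) = scal c * coproduct_word w"
  by (subst coproduct_superset[of "{w}"]) auto

definition b_rep :: "'i \<Rightarrow> 'i gen free_alg" where
  "b_rep i = letter (Fgen i) + scal (inverse vv) * letter (Egen i) * letter (Kinvgen i)"

text \<open>In the free tensor square the representatives differ by v^-1 e k^-1 tensor (k k^-1 - 1),
  a left multiple of a generator of the ideal.\<close>

lemma coproduct_b:
  "cls2 a (coproduct (b_rep i)) = cls2 a (tens (b_rep i) 1 + tens (letter (Kinvgen i)) (b_rep i))"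
proof -
  interpret ideal "U2_ideal a" "ring_of_type_algebra" by (rule U2_ideal)
  let ?e = "Egen i" and ?f = "Fgen i" and ?k = "Kgen i" and ?l = "Kinvgen i"
  let ?S = "\<lambda>xs ys c. Poly_Mapping.single (Word xs, Word ys) c :: 'i gen free_alg2"
  have b_rep: "b_rep i = Poly_Mapping.single (Word [?f]) 1 + Poly_Mapping.single (Word [?e, ?l]) (inverse vv)"
    by (simp add: b_rep_def letter_def scal_def mult_single zero_word_def)
  have one: "(1 :: 'i gen free_alg) = Poly_Mapping.single (Word []) 1"
    by (simp add: zero_word_def flip: single_one)
  have zero: "(0 :: 'i gen word \<times> 'i gen word) = (Word [], Word [])"
    by (simp add: zero_prod_def zero_word_def)
  have one2: "(1 :: 'i gen free_alg2) = ?S [] [] 1"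
    by (simp add: zero flip: single_one)
  have tens: "tens (b_rep i) 1 + tens (letter ?l) (b_rep i) =
      ?S [?f] [] 1 + ?S [?e, ?l] [] (inverse vv) + (?S [?l] [?f] 1 + ?S [?l] [?e, ?l] (inverse vv))"
    unfolding b_rep by (simp add: one letter_def tens_add tens_single)
  have cop: "coproduct (b_rep i) =
      ?S [?f] [] 1 + ?S [?l] [?f] 1 + (?S [?e, ?l] [?k, ?l] (inverse vv) + ?S [?l] [?e, ?l] (inverse vv))"
    unfolding b_rep coproduct_add coproduct_single
    by (simp add: one letter_def tens_single scal_def zero mult_single distrib_left distrib_right one2)
  have "coproduct (b_rep i) - (tens (b_rep i) 1 + tens (letter ?l) (b_rep i)) =
      ?S [?e, ?l] [?k, ?l] (inverse vv) - ?S [?e, ?l] [] (inverse vv)"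
    unfolding tens cop by simp
  also have "\<dots> = ?S [?e, ?l] [] (inverse vv) * tens 1 (letter ?k * letter ?l - 1)"
  proof -
    have "tens 1 (letter ?k * letter ?l - 1) + ?S [] [] 1 = tens 1 (letter ?k * letter ?l)"
      using tens_add(2)[of 1 "letter ?k * letter ?l - 1" 1] by (simp add: one tens_single)
    also have "\<dots> = ?S [] [?k, ?l] 1"
      by (simp add: one letter_def mult_single tens_single)
    finally have "tens 1 (letter ?k * letter ?l - 1) = ?S [] [?k, ?l] 1 - ?S [] [] 1"
      by (simp add: algebra_simps)
    then show ?thesis by (simp add: right_diff_distrib mult_single)
  qed
  also have "\<dots> \<in> U2_ideal a"
  proof -
    have "letter ?k * letter ?l - 1 \<in> relators a" unfolding relators_def by blast
    then have "tens 1 (letter ?k * letter ?l - 1) \<in> U2_ideal a"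
      unfolding U2_ideal_def by (intro subsetD[OF genideal_self]) auto
    then show ?thesis using I_l_closed[of "tens 1 (letter ?k * letter ?l - 1)"] by simp
  qed
  finally have mem: "coproduct (b_rep i) - (tens (b_rep i) 1 + tens (letter ?l) (b_rep i)) \<in> U2_ideal a" .
  show ?thesis
    unfolding cls2_def using mem by (subst quotient_eq_iff_same_a_r_cos[symmetric]) (auto simp: U2_ideal ring_of_type_algebra_minus)
qed

section \<open>Modules of the iquantum group\<close>

lemma b_eq: "Defs.b a i = cls a (b_rep i)"
  by (simp add: Defs.b_def b_rep_def)

locale U_iota_module =
  fixes a :: "'i \<Rightarrow> 'i \<Rightarrow> int" and s :: "Cq \<Rightarrow> 'w::ab_group_add \<Rightarrow> 'w" and \<sigma> :: "'i gen free_alg set \<Rightarrow> 'w \<Rightarrow> 'w"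
  assumes is_module: "is_module a (U_iota a) s \<sigma>"
begin

lemma \<sigma>: "\<sigma> \<in> ring_hom (U_iota a) (End_ring s)" and \<sigma>_scal: "\<sigma> (cls a (scal c)) = s c"
  and vs: "vector_space s"
  using is_module by (auto simp: is_module_def)

lemma \<sigma>_linear: "x \<in> U_iota_set a \<Longrightarrow> Vector_Spaces.linear s s (\<sigma> x)"
  using ring_hom_closed[OF \<sigma>, of x] by simp

lemma \<sigma>_mult: "x \<in> U_iota_set a \<Longrightarrow> y \<in> U_iota_set a \<Longrightarrow> \<sigma> (x \<otimes>\<^bsub>U a\<^esub> y) w = \<sigma> x (\<sigma> y w)"
  using ring_hom_mult[OF \<sigma>, of x y] by simp

lemma \<sigma>_add: "x \<in> U_iota_set a \<Longrightarrow> y \<in> U_iota_set a \<Longrightarrow> \<sigma> (x \<oplus>\<^bsub>U a\<^esub> y) w = \<sigma> x w + \<sigma> y w"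
  using ring_hom_add[OF \<sigma>, of x y] by simp

lemma \<sigma>_1: "\<sigma> \<one>\<^bsub>U a\<^esub> w = w"
  using ring_hom_one[OF \<sigma>] by simp

lemma \<sigma>_diff:
  assumes "x \<in> U_iota_set a" "y \<in> U_iota_set a"
  shows "\<sigma> (x \<ominus>\<^bsub>U a\<^esub> y) w = \<sigma> x w - \<sigma> y w"
proof -
  interpret U: ring "U a" by (rule U_ring)
  have "x \<in> carrier (U a)" "y \<in> carrier (U a)" using assms U_iota_set_subset by auto
  then have "(x \<ominus>\<^bsub>U a\<^esub> y) \<oplus>\<^bsub>U a\<^esub> y = x"
    by (simp add: a_minus_def U.a_assoc U.l_neg)
  then have "\<sigma> x w = \<sigma> (x \<ominus>\<^bsub>U a\<^esub> y) w + \<sigma> y w"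
    using \<sigma>_add[of "x \<ominus>\<^bsub>U a\<^esub> y" y w] assms U_iota_set_intros(7)[OF assms] by simp
  then show ?thesis by simp
qed

lemmas \<sigma>_simps = \<sigma>_mult \<sigma>_diff \<sigma>_1 \<sigma>_scal U_iota_set_intros xdp_in_U_iota

text \<open>On an eigenvector the recursion for \<open>xdp\<close> multiplies by lam j - lam m at
  step m, up to the normalizing scalar, because \<open>lam_D_coeff\<close> evaluates the shift by
  D.\<close>

lemma xdp_eigenvector:
  assumes "w \<in> eig s (\<sigma> (Defs.b a i)) (lam j)"
  shows "\<sigma> (xdp a i n) w = s (qq ^ n * tcoeff j n) w"
proof -
  interpret vector_space s by (rule vs)
  have lin: "\<sigma> (xdp a i n) (s c x) = s c (\<sigma> (xdp a i n) x)" for n c x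
    by (rule linear_simps[OF \<sigma>_linear[OF xdp_in_U_iota]])
  have 1: "\<sigma> (xdp a i 1) w = s (lam j - lam 0) w"
    using assms by (simp add: eig_def \<sigma>_simps lam_0 scale_left_diff_distrib)
  have "qq ^ 2 - inverse (qq ^ 2) \<noteq> 0"
    using vv_ne_inverse(1) by (simp add: qq_vv(3) algebra_simps)
  then have qint_1: "qint (qq ^ 2) 1 = 1" by (simp add: qint_def)
  have step: "\<sigma> (xdp a i (Suc (Suc n))) w =
      s ((- 1) ^ Suc n / qint (qq ^ 2) (int (Suc n) + 1) * (lam j - lam (int (Suc n)))) (\<sigma> (xdp a i (Suc n)) w)" for n
  proof -
    define m where "m = Suc n"
    have "\<sigma> (xdp a i (Suc (Suc n))) w = s ((- 1) ^ m / qint (qq ^ 2) (int m + 1))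
        (\<sigma> (xdp a i m) (\<sigma> (xdp a i 1) w) - s ((- 1) ^ m * D_coeff m (m + 1)) (\<sigma> (xdp a i m) w))"
      unfolding xdp.simps(3)[of a i n] Let_def
      unfolding m_def[symmetric]
      by (simp only: \<sigma>_simps)
    also have "\<dots> = s ((- 1) ^ m / qint (qq ^ 2) (int m + 1) * (lam j - lam 0 - (- 1) ^ m * D_coeff m (m + 1))) (\<sigma> (xdp a i m) w)"
      unfolding 1 lin by (simp only: scale_scale flip: scale_left_diff_distrib)
    also have "lam j - lam 0 - (- 1) ^ m * D_coeff m (m + 1) = lam j - lam (int m)"
      unfolding lam_D_coeff[symmetric] by simp
    finally show ?thesis unfolding m_def .
  qed
  show ?thesis
  proof (induction n)
    case 0
    show ?case by (simp add: \<sigma>_1)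
  next
    case (Suc n)
    show ?case
    proof (cases n)
      case 0
      then show ?thesis using 1 by (simp add: qint_1)
    next
      case (Suc m)
      \<comment> \<open>Were the quantum integer 0, both sides would be 0 by the convention x / 0 =
        0.\<close>
      have "qq ^ Suc n * tcoeff j (Suc n) =
          (- 1) ^ n / qint (qq ^ 2) (int n + 1) * (lam j - lam (int n)) * (qq ^ n * tcoeff j n)"
        by (cases "qint (qq ^ 2) (int n + 1) = 0") (simp_all add: divide_simps)
      then show ?thesis
        using step[of m] unfolding Suc[symmetric] by (simp only: Suc.IH scale_scale)
    qed
  qed
qed

text \<open>The powers of q cancel and \<open>tcoeff\<close> vanishes beyond n, so
  \<open>Sum_any\<close> is the finite sum evaluated by \<open>tcoeff_sum\<close>.\<close>

lemma iT_eigenvector: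
  assumes "w \<in> eig s (\<sigma> (Defs.b a i)) (lam (int n))"
  shows "iT a s \<sigma> i w = s (tau (int n)) w"
proof -
  interpret vector_space s by (rule vs)
  have *: "s (qq powi (- int k)) (\<sigma> (xdp a i k) w) = s (tcoeff (int n) k) w" for k
    using xdp_eigenvector[OF assms] by (simp add: power_int_minus)
  have "iT a s \<sigma> i w = (\<Sum>k\<le>n. s (tcoeff (int n) k) w)"
    unfolding iT_def *
    by (rule Sum_any.expand_superset) (use tcoeff_eq_0 in \<open>auto simp: not_le[symmetric]\<close>)
  then show ?thesis
    by (simp add: tcoeff_sum flip: scale_sum_left)
qed

text \<open>An eigenbasis is finite, so the indices of its eigenvalues have a bound, beyond which
  \<open>xdp\<close> kills every basis vector.\<close>

lemma xdp_eventually_0: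
  assumes "finite A" "module.span s A = UNIV"
    and eig_span: "module.span s (\<Union>c\<in>range (\<lambda>n. lam (int n)). eig s (\<sigma> (Defs.b a i)) c) = UNIV"
  obtains m where "\<And>n. n \<ge> m \<Longrightarrow> \<sigma> (xdp a i n) = (\<lambda>_. 0)"
proof -
  interpret vector_space s by (rule vs)
  obtain C where C: "is_basis s C" "\<forall>w\<in>C. \<exists>c\<in>range (\<lambda>n. lam (int n)). \<sigma> (Defs.b a i) w = s c w"
    using diagonalizable_with_if_eig_span[OF vs eig_span] unfolding diagonalizable_with_def by blast
  have "finite C" using finite_basis[OF vs assms(1,2) C(1)] .
  obtain h where h: "\<And>w. w \<in> C \<Longrightarrow> w \<in> eig s (\<sigma> (Defs.b a i)) (lam (int (h w)))"
    using bchoice[of C "\<lambda>w n. w \<in> eig s (\<sigma> (Defs.b a i)) (lam (int n))"] C(2) by (auto simp: eig_def)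
  obtain m where m: "\<And>w. w \<in> C \<Longrightarrow> h w \<le> m"
    using finite_nat_set_iff_bounded_le[of "h ` C"] \<open>finite C\<close> by auto
  have "\<sigma> (xdp a i n) = (\<lambda>_. 0)" if "n \<ge> Suc m" for n
  proof (rule linear_eq_if_eq_on_spanning[OF \<sigma>_linear[OF xdp_in_U_iota]])
    show "Vector_Spaces.linear s s (\<lambda>_. 0)" by (auto simp: Vector_Spaces.linear_iff vs)
    show "span C = UNIV" using C(1) by (simp add: is_basis_def)
    show "\<sigma> (xdp a i n) w = 0" if "w \<in> C" for w
    proof -
      have "h w < n" using m[OF that] \<open>n \<ge> Suc m\<close> by simp
      then show ?thesis using xdp_eigenvector[OF h[OF that]] by (simp add: tcoeff_eq_0)
    qed
  qed
  then show thesis by (rule that)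
qed

text \<open>A bound valid for all vectors makes \<open>iT\<close> a fixed finite sum, whereas the
  support seen by \<open>Sum_any\<close> depends on the vector.\<close>

lemma iT_linear:
  assumes "\<And>n. n \<ge> m \<Longrightarrow> \<sigma> (xdp a i n) = (\<lambda>_. 0)"
  shows "Vector_Spaces.linear s s (iT a s \<sigma> i)"
proof -
  interpret vector_space s by (rule vs)
  note lin = linear_simps[OF \<sigma>_linear[OF xdp_in_U_iota]]
  have "iT a s \<sigma> i w = (\<Sum>n<m. s (qq powi (- int n)) (\<sigma> (xdp a i n) w))" for w
    unfolding iT_def
  proof (intro Sum_any.expand_superset subsetI)
    fix n assume "n \<in> {n. s (qq powi (- int n)) (\<sigma> (xdp a i n) w) \<noteq> 0}"
    then show "n \<in> {..<m}"
      using assms[of n] by (cases "n < m") simp_all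
  qed simp
  then show ?thesis
    using vs by (auto simp: Vector_Spaces.linear_iff lin scale_right_distrib sum.distrib scale_sum_right mult.commute)
qed

end

section \<open>The theorem\<close>

text \<open>The clause on eventual vanishing certifies that \<open>iT\<close> is the intended sum,
  since \<open>Sum_any\<close> defaults to 0 on infinite support.\<close>

theorem proposition1p17:
  fixes a :: "'i::finite \<Rightarrow> 'i \<Rightarrow> int"
    and sV :: "Cq \<Rightarrow> 'v::ab_group_add \<Rightarrow> 'v" and \<rho> :: "'i gen free_alg set \<Rightarrow> 'v \<Rightarrow> 'v"
    and sN :: "Cq \<Rightarrow> 'n::ab_group_add \<Rightarrow> 'n" and \<chi> :: "'i gen free_alg set \<Rightarrow> 'n \<Rightarrow> 'n" and u :: 'n
    and sW :: "Cq \<Rightarrow> 'w::ab_group_add \<Rightarrow> 'w" and \<sigma> :: "'i gen free_alg set \<Rightarrow> 'w \<Rightarrow> 'w"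
    and t :: "'v \<Rightarrow> 'n \<Rightarrow> 'w"
  assumes "simply_laced_cartan a"
    and "is_module a (U a) sV \<rho>" and "\<exists>B. finite B \<and> is_basis sV B" and "type_I a sV \<rho>"
    and "is_N a sN \<chi> u"
    and "is_tensor_product sV sN sW t"
    and "is_module a (U_iota a) sW \<sigma>" and "acts_via_coproduct a \<rho> \<chi> t \<sigma>"
  shows "nonclassical a sW \<sigma> \<and>
    (\<forall>i. \<exists>m. \<forall>n\<ge>m. \<sigma> (xdp a i n) = (\<lambda>_. 0)) \<and>
    (\<forall>i. bij (iT a sW \<sigma> i)) \<and>
    (\<forall>i j. a i j = - 1 \<longrightarrow>
       iT a sW \<sigma> i \<circ> iT a sW \<sigma> j \<circ> iT a sW \<sigma> i = iT a sW \<sigma> j \<circ> iT a sW \<sigma> i \<circ> iT a sW \<sigma> j) \<and>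
    (\<forall>i j. a i j = 0 \<longrightarrow> iT a sW \<sigma> i \<circ> iT a sW \<sigma> j = iT a sW \<sigma> j \<circ> iT a sW \<sigma> i)"
proof -
  interpret V: U_module a sV \<rho> by (unfold_locales) fact
  interpret W: U_iota_module a sW \<sigma> by (unfold_locales) fact
  interpret N: U_iota_module a sN \<chi> using assms(5) by (unfold_locales) (simp add: is_N_def)
  have diag: "a i i = 2" and sym: "a i j = a j i" for i j
    using assms(1) by (simp_all add: simply_laced_cartan_def)
  interpret Q: qg_module sV a "\<lambda>i. \<rho> (cls a (letter (Egen i)))" "\<lambda>i. \<rho> (cls a (letter (Fgen i)))"
    "\<lambda>i. \<rho> (cls a (letter (Kgen i)))" "\<lambda>i. \<rho> (cls a (letter (Kinvgen i)))"
    by (rule V.qg_module[OF diag sym])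
  interpret SW: vector_space sW by (rule W.vs)
  obtain A where A: "finite A" "is_basis sV A" using assms(3) by blast
  have A_span: "Q.span A = UNIV" using A(2) by (simp add: is_basis_def)
  \<comment> \<open>This map carries \<open>Q.B i\<close> to the action of b_i. It is surjective
    because u alone is a basis of N.\<close>
  define \<phi> where "\<phi> v = t v u" for v
  have lin1: "Vector_Spaces.linear sV sW (\<lambda>v. t v n)" and lin2: "Vector_Spaces.linear sN sW (t v)" for v n
    using assms(6) by (auto simp: is_tensor_product_def)
  have t_scale: "t v (sN c n) = sW c (t v n)" for v c n
    using lin2 by (simp add: Vector_Spaces.linear_iff)
  have \<phi>_linear: "Vector_Spaces.linear sV sW \<phi>"
    using lin1[of u] by (simp add: \<phi>_def[abs_def])
  interpret \<phi>: Vector_Spaces.linear sV sW \<phi> by (rule \<phi>_linear)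
  have "is_basis sW ((\<lambda>(v, n). t v n) ` (A \<times> {u}))"
    using assms(5,6) A(2) by (simp add: is_tensor_product_def is_N_def)
  moreover have "(\<lambda>(v, n). t v n) ` (A \<times> {u}) = \<phi> ` A"
    by (force simp: \<phi>_def)
  ultimately have W_span: "SW.span (\<phi> ` A) = UNIV"
    by (simp add: is_basis_def)
  have surj: "\<phi> ` Q.span S = UNIV" if "Q.span S = UNIV" for S
    using W_span \<phi>.span_image[of A] A_span that by simp

  have \<sigma>_b: "\<sigma> (Defs.b a i) (\<phi> v) = \<phi> (Q.B i v)" for i v
  proof -
    \<comment> \<open>The two pure tensors in the coproduct of b_i; their second factors 1 and b_i
      lie in the coideal subalgebra, as \<open>acts_via_coproduct\<close> demands.\<close>
    define ps where "ps = [(b_rep i, 1 :: 'i gen free_alg), (letter (Kinvgen i), b_rep i)]"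
    have "cls a (b_rep i) \<in> carrier (U_iota a)" "cls a 1 \<in> carrier (U_iota a)"
      using U_iota_set_intros(1,3)[of a] by (simp_all add: cls_1 flip: b_eq)
    then have "\<sigma> (cls a (b_rep i)) (t v u) = (\<Sum>(y, z)\<leftarrow>ps. t (\<rho> (cls a y) v) (\<chi> (cls a z) u))"
      using assms(8) coproduct_b[of a i] unfolding acts_via_coproduct_def
      by (intro mp[OF spec[OF spec[OF assms(8)[unfolded acts_via_coproduct_def]]], rule_format]) (auto simp: ps_def)
    also have "\<dots> = t (\<rho> (cls a (b_rep i)) v) u + t (\<rho> (cls a (letter (Kinvgen i))) v) (sN (1 / qint qq 2) u)"
      using assms(5) by (simp add: ps_def cls_1 N.\<sigma>_1 is_N_def flip: b_eq)
    also have "\<dots> = \<phi> (Q.B i v)"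
      unfolding t_scale \<phi>_def[symmetric]
      by (simp add: Q.B_def b_rep_def V.\<rho>_simps \<phi>.add \<phi>.scale)
    finally show ?thesis by (simp add: b_eq \<phi>_def)
  qed

  have eig_span: "SW.span (\<Union>c\<in>range (\<lambda>n. lam (int n)). eig sW (\<sigma> (Defs.b a i)) c) = UNIV" for i
  proof -
    let ?S = "\<Union>c\<in>range (\<lambda>n. lam (int n)). eig sV (Q.B i) c"
    have "Q.span ?S = UNIV"
      using assms(4) by (intro Q.eig_B_span[OF A(1) A_span]) (simp add: type_I_def)
    then have "SW.span (\<phi> ` ?S) = UNIV"
      using surj \<phi>.span_image by metis
    moreover have "\<phi> ` ?S \<subseteq> (\<Union>c\<in>range (\<lambda>n. lam (int n)). eig sW (\<sigma> (Defs.b a i)) c)"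
      by (auto simp: eig_def \<sigma>_b \<phi>.scale)
    ultimately show ?thesis using SW.span_mono by blast
  qed

  have b_linear: "Vector_Spaces.linear sW sW (\<sigma> (Defs.b a i))" for i
    by (rule W.\<sigma>_linear[OF U_iota_set_intros(1)])
  have surj_\<phi>: "\<exists>v. w = \<phi> v" for w
    using surj[OF A_span] A_span by auto
  have vanish: "\<exists>m. \<forall>n\<ge>m. \<sigma> (xdp a i n) = (\<lambda>_. 0)" for i
    using W.xdp_eventually_0[OF _ W_span eig_span] A(1) by (metis finite_imageI)
  have T_linear: "Vector_Spaces.linear sW sW (iT a sW \<sigma> i)" for i
    using vanish[of i] W.iT_linear by blast
  have "nonclassical a sW \<sigma>"
    unfolding nonclassical_def lam_of_nat
    using assms(7) diagonalizable_with_if_eig_span[OF W.vs eig_span] by blast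
  moreover have "bij (iT a sW \<sigma> i)" for i
  proof (rule bij_if_eig_nonzero[OF T_linear])
    have "(\<Union>c\<in>range (\<lambda>n. lam (int n)). eig sW (\<sigma> (Defs.b a i)) c) \<subseteq> (\<Union>c\<in>-{0}. eig sW (iT a sW \<sigma> i) c)"
    proof
      fix w assume "w \<in> (\<Union>c\<in>range (\<lambda>n. lam (int n)). eig sW (\<sigma> (Defs.b a i)) c)"
      then obtain n where "w \<in> eig sW (\<sigma> (Defs.b a i)) (lam (int n))" by auto
      then have "w \<in> eig sW (iT a sW \<sigma> i) (tau (int n))"
        using W.iT_eigenvector by (auto simp: eig_def)
      then show "w \<in> (\<Union>c\<in>-{0}. eig sW (iT a sW \<sigma> i) c)"
        using tau_nonzero[of "int n"] by blast
    qed
    then show "SW.span (\<Union>c\<in>-{0}. eig sW (iT a sW \<sigma> i) c) = UNIV"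
      using eig_span[of i] SW.span_mono by blast
  qed
  moreover have "iT a sW \<sigma> i \<circ> iT a sW \<sigma> j \<circ> iT a sW \<sigma> i = iT a sW \<sigma> j \<circ> iT a sW \<sigma> i \<circ> iT a sW \<sigma> j"
    if "a i j = - 1" for i j
  proof -
    \<comment> \<open>Stated for arbitrary indices, so that the symmetry of the Cartan matrix
      supplies both relations needed for the braid relation.\<close>
    have serre: "serre sW (\<sigma> (Defs.b a i)) (\<sigma> (Defs.b a j)) w = \<sigma> (Defs.b a j) w"
      if "a i j = - 1" for i j w
    proof -
      obtain v where w: "w = \<phi> v" using surj_\<phi> by blast
      have "serre sW (\<sigma> (Defs.b a i)) (\<sigma> (Defs.b a j)) w = \<phi> (serre sV (Q.B i) (Q.B j) v)"
        by (simp add: serre_def w \<sigma>_b \<phi>.add \<phi>.diff \<phi>.scale)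
      then show ?thesis by (simp add: Q.serre_B[OF that] w \<sigma>_b)
    qed
    show ?thesis
      by (rule braid_relation[OF b_linear[of i] b_linear[of j] T_linear T_linear eig_span eig_span])
        (use that sym[of j i] in \<open>simp_all add: W.iT_eigenvector serre\<close>)
  qed
  moreover have "iT a sW \<sigma> i \<circ> iT a sW \<sigma> j = iT a sW \<sigma> j \<circ> iT a sW \<sigma> i"
    if "a i j = 0" for i j
  proof -
    \<comment> \<open>Diagonal entries are 2, so a zero entry lies off the diagonal.\<close>
    have "i \<noteq> j" using that diag[of i] by auto
    have "\<sigma> (Defs.b a i) (\<sigma> (Defs.b a j) w) = \<sigma> (Defs.b a j) (\<sigma> (Defs.b a i) w)" for w
    proof -
      obtain v where "w = \<phi> v" using surj_\<phi> by blast
      then show ?thesis by (simp add: \<sigma>_b Q.B_commute[OF \<open>i \<noteq> j\<close> that])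
    qed
    then show ?thesis
      by (intro commuting_relation[OF b_linear[of i] T_linear T_linear eig_span eig_span[of j]] W.iT_eigenvector)
  qed
  ultimately show ?thesis using vanish by blast
qed

end
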